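(* Let $w$ be a permutation. The maps $\{\mathfrak{d}_i\}_{1<i<\mathrm{inv}(w)}$ form a dual equivalence for $(R(w),\mathrm{Des})$. In particular, the Stanley symmetric function $S_w(X)=\sum_{\rho\in R(w)}F_{\mathrm{Des}(\rho)}(X)$ is a symmetric function and is Schur positive (a nonnegative integer linear combination of Schur functions).
   Context: Compositions. A weak composition is a finite sequence of nonnegative integers, a strong composition is a finite sequence of positive integers, and it is a composition of $N$ if its parts sum to $N$. For a weak composition $b$, $\mathrm{flat}(b)$ is the strong composition obtained by deleting zero parts. A strong composition $\beta$ refines $\alpha$ if there are indices $i_1<i_2<\cdots$ with $\beta_1+\cdots+\beta_{i_j}=\alpha_1+\cdots+\alpha_j$ for all $j$. The fundamental quasisymmetric function is $F_\alpha(X)=\sum x^b$, over weak compositions $b$ such that $\mathrm{flat}(b)$ refines $\alpha$, in the variables $X=\{x_1,x_2,\dots\}$. Schur functions. Partitions have Young diagrams in French notation (row $i$ from the bottom has $\lambda_i$ left-justified cells). $\mathrm{SYT}(\lambda)$ is the set of bijective fillings of the diagram of $\lambda$ with $1,\dots,N$ ($N=|\lambda|$) increasing along rows and up columns. $i$ is a descent of $T$ if $i+1$ lies weakly left of $i$; $\mathrm{Des}(T)$ is the strong composition of $N$ given by the lengths of the successive maximal runs of $1,2,\dots,N$ between descents. $s_\lambda(X)=\sum_{T\in\mathrm{SYT}(\lambda)}F_{\mathrm{Des}(T)}(X)$. Reduced expressions. $R(w)$ is the set of reduced expressions $\rho=(\rho_k,\dots,\rho_1)$, $k=\mathrm{inv}(w)$,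 with $w=s_{\rho_k}\cdots s_{\rho_1}$, $s_i$ the simple transposition interchanging $i$ and $i+1$; the convention is that the one-line notation of $w$ is obtained from the identity by interchanging the entries in positions $\rho_1,\rho_1+1$, then those in positions $\rho_2,\rho_2+1$, and so on up to $\rho_k$ (for example $(4,2,1,2,3)\in R(42153)$). Letters are indexed from right to left. The run decomposition $\rho^{(r)}|\cdots|\rho^{(1)}$ of $\rho$ cuts the word, read left to right, into increasing sequences of maximal length, and $\mathrm{Des}(\rho)=(|\rho^{(1)}|,\dots,|\rho^{(r)}|)$. The maps $\mathfrak{d}_i$. For $\rho\in R(w)$ and $1<i<\mathrm{inv}(w)$: $\mathfrak{d}_i(\rho)=\mathfrak{b}_i(\rho)$ if $\rho_{i+1}=\rho_{i-1}=\rho_i\pm1$; $\mathfrak{d}_i(\rho)=\mathfrak{s}_{i-1}(\rho)$ if $\rho_{i-1}>\rho_{i+1}>\rho_i$ or $\rho_{i-1}<\rho_{i+1}<\rho_i$; $\mathfrak{d}_i(\rho)=\mathfrak{s}_i(\rho)$ if $\rho_{i+1}>\rho_{i-1}>\rho_i$ or $\rho_{i+1}<\rho_{i-1}<\rho_i$; $\mathfrak{d}_i(\rho)=\rho$ otherwise. Here $\mathfrak{s}_j$ interchanges the letters $\rho_j$ and $\rho_{j+1}$, and $\mathfrak{b}_j$ replaces the three letters in positions $j-1,j,j+1$, with values $x,y,x$, by $y,x,y$. Dual equivalence. Let $\mathcal{A}$ be a finite set and $\mathrm{Des}$ a map from $\mathcal{A}$ to strong compositions of $N$. For $1\le h\le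 i\le N$, $\mathrm{Des}_{(h,i)}(T)$ is the strong composition of $i-h+1$ obtained from $\mathrm{Des}(T)$ by deleting the first $h-1$ units and the last $N-i$ units (e.g. $\mathrm{Des}(T)=(3,2,3,1)$ gives $\mathrm{Des}_{(3,8)}(T)=(1,2,3)$). A dual equivalence for $(\mathcal{A},\mathrm{Des})$ is a family of involutions $\{\varphi_i\}_{1<i<N}$ on $\mathcal{A}$ such that (i) for all $1<h\le i<N$ with $i-h\le 3$ and all $T\in\mathcal{A}$ there is a partition $\lambda$ of $i-h+3$ with $\sum_{U\in[T]_{(h,i)}}F_{\mathrm{Des}_{(h-1,i+1)}(U)}(X)=s_\lambda(X)$, where $[T]_{(h,i)}$ is the equivalence class of $T$ generated by $\varphi_h,\dots,\varphi_i$; and (ii) $\varphi_j\varphi_i(T)=\varphi_i\varphi_j(T)$ for all $|i-j|\ge3$ and all $T\in\mathcal{A}$. *)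

theory Defs
  imports "HOL-Library.Poly_Mapping" "HOL-Library.FuncSet" "HOL-Combinatorics.Permutations"
begin

section \<open>Compositions and quasisymmetric functions\<close>

definition strong_composition :: "nat list \<Rightarrow> nat \<Rightarrow> bool" where
  "strong_composition \<alpha> N \<longleftrightarrow> (\<forall>a\<in>set \<alpha>. 0 < a) \<and> sum_list \<alpha> = N"

definition flat :: "nat list \<Rightarrow> nat list" where
  "flat b = filter (\<lambda>a. 0 < a) b"

text \<open>Refinement is a relation between compositions of the same number, hence the first
  conjunct; the displayed partial-sum condition alone would also hold if \<open>\<beta>\<close> had surplus parts.\<close>

definition refines :: "nat list \<Rightarrow> nat list \<Rightarrow> bool" where
  "refines \<beta> \<alpha> \<longleftrightarrow> sum_list \<beta> = sum_list \<alpha> \<and>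
     (\<exists>i :: nat \<Rightarrow> nat. strict_mono_on {1..length \<alpha>} i \<and>
        (\<forall>j\<in>{1..length \<alpha>}. i j \<le> length \<beta> \<and> sum_list (take (i j) \<beta>) = sum_list (take j \<alpha>)))"

text \<open>A formal power series in \<open>x\<^sub>1, x\<^sub>2, \<dots>\<close> is given by its coefficients; the exponent of
  \<open>x\<^sub>k\<^sub>+\<^sub>1\<close> in a monomial is the value of the exponent vector at \<open>k\<close>.\<close>

type_synonym power_series = "(nat \<Rightarrow>\<^sub>0 nat) \<Rightarrow> int"

text \<open>Weak compositions differing by trailing zeros give the same monomial \<open>x\<^sup>b\<close>,
  which occurs only once in the sum defining \<open>F\<^sub>\<alpha>\<close>.\<close>

definition fundamental :: "nat list \<Rightarrow> power_series" where
  "fundamental \<alpha> = (\<lambda>m. of_bool (\<exists>b. Poly_Mapping.nth b = m \<and> refines (flat b) \<alpha>))"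

definition symmetric_function :: "power_series \<Rightarrow> bool" where
  "symmetric_function f \<longleftrightarrow>
     (\<exists>d. \<forall>m. f m \<noteq> 0 \<longrightarrow> (\<Sum>k\<in>Poly_Mapping.keys m. Poly_Mapping.lookup m k) \<le> d) \<and>
     (\<forall>\<pi>. bij \<pi> \<longrightarrow> (\<forall>m. f (Poly_Mapping.map_key \<pi> m) = f m))"

section \<open>Schur functions\<close>

text \<open>\<open>runs P xs\<close> cuts \<open>xs\<close> between exactly those neighbours \<open>x, y\<close> with \<open>\<not> P x y\<close>.\<close>

fun runs :: "('a \<Rightarrow> 'a \<Rightarrow> bool) \<Rightarrow> 'a list \<Rightarrow> 'a list list" where
  "runs P [] = []"
| "runs P [x] = [[x]]"
| "runs P (x # y # zs) =
     (if P x y then (x # hd (runs P (y # zs))) # tl (runs P (y # zs))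
      else [x] # runs P (y # zs))"

definition is_partition :: "nat list \<Rightarrow> bool" where
  "is_partition lam \<longleftrightarrow> sorted_wrt (\<ge>) lam \<and> (\<forall>a\<in>set lam. 0 < a)"

text \<open>Cells are pairs (row, column), both counted from 0, with row 0 at the bottom.\<close>

definition diagram :: "nat list \<Rightarrow> (nat \<times> nat) set" where
  "diagram lam = {(r, c). r < length lam \<and> c < lam ! r}"

definition SYT :: "nat list \<Rightarrow> (nat \<times> nat \<Rightarrow> nat) set" where
  "SYT lam = {T \<in> diagram lam \<rightarrow>\<^sub>E {1..sum_list lam}.
     bij_betw T (diagram lam) {1..sum_list lam} \<and>
     (\<forall>r c. (r, Suc c) \<in> diagram lam \<longrightarrow> T (r, c) < T (r, Suc c)) \<and>
     (\<forall>r c. (Suc r, c) \<in> diagram lam \<longrightarrow> T (r, c) < T (Suc r, c))}"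

definition tableau_descent :: "nat list \<Rightarrow> (nat \<times> nat \<Rightarrow> nat) \<Rightarrow> nat \<Rightarrow> bool" where
  "tableau_descent lam T i \<longleftrightarrow>
     (\<exists>x\<in>diagram lam. \<exists>y\<in>diagram lam. T x = i \<and> T y = Suc i \<and> snd y \<le> snd x)"

definition tableau_Des :: "nat list \<Rightarrow> (nat \<times> nat \<Rightarrow> nat) \<Rightarrow> nat list" where
  "tableau_Des lam T =
     map length (runs (\<lambda>i j. \<not> tableau_descent lam T i) [1..<Suc (sum_list lam)])"

definition schur :: "nat list \<Rightarrow> power_series" where
  "schur lam = (\<lambda>m. \<Sum>T\<in>SYT lam. fundamental (tableau_Des lam T) m)"

definition schur_positive :: "power_series \<Rightarrow> bool" where
  "schur_positive f \<longleftrightarrow>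
     (\<exists>\<Lambda> (c :: nat list \<Rightarrow> nat). finite \<Lambda> \<and> (\<forall>lam\<in>\<Lambda>. is_partition lam) \<and>
        f = (\<lambda>m. \<Sum>lam\<in>\<Lambda>. int (c lam) * schur lam m))"

section \<open>Dual equivalence\<close>

fun drop_units :: "nat \<Rightarrow> nat list \<Rightarrow> nat list" where
  "drop_units k [] = []"
| "drop_units k (a # \<alpha>) = (if k < a then (a - k) # \<alpha> else drop_units (k - a) \<alpha>)"

definition restrict_composition :: "nat \<Rightarrow> nat \<Rightarrow> nat list \<Rightarrow> nat list" where
  "restrict_composition h i \<alpha> =
     rev (drop_units (sum_list \<alpha> - i) (rev (drop_units (h - 1) \<alpha>)))"

lemma "restrict_composition 3 8 [3, 2, 3, 1] = [1, 2, 3]"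
  by (simp add: restrict_composition_def)

definition generated_class :: "'a set \<Rightarrow> (nat \<Rightarrow> 'a \<Rightarrow> 'a) \<Rightarrow> nat \<Rightarrow> nat \<Rightarrow> 'a \<Rightarrow> 'a set" where
  "generated_class A \<phi> h i T =
     {U. equivclp (\<lambda>V V'. V \<in> A \<and> (\<exists>j\<in>{h..i}. V' = \<phi> j V)) T U}"

definition dual_equivalence ::
  "'a set \<Rightarrow> ('a \<Rightarrow> nat list) \<Rightarrow> nat \<Rightarrow> (nat \<Rightarrow> 'a \<Rightarrow> 'a) \<Rightarrow> bool" where
  "dual_equivalence A Des N \<phi> \<longleftrightarrow>
     finite A \<and>
     (\<forall>T\<in>A. strong_composition (Des T) N) \<and>
     (\<forall>i. 1 < i \<and> i < N \<longrightarrow> (\<forall>T\<in>A. \<phi> i T \<in> A \<and> \<phi> i (\<phi> i T) = T)) \<and>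
     (\<forall>h i. 1 < h \<and> h \<le> i \<and> i < N \<and> i - h \<le> 3 \<longrightarrow>
        (\<forall>T\<in>A. \<exists>lam. is_partition lam \<and> sum_list lam = i - h + 3 \<and>
           (\<lambda>m. \<Sum>U\<in>generated_class A \<phi> h i T.
              fundamental (restrict_composition (h - 1) (i + 1) (Des U)) m) = schur lam)) \<and>
     (\<forall>i j. 1 < i \<and> i < N \<and> 1 < j \<and> j < N \<and> \<bar>int i - int j\<bar> \<ge> 3 \<longrightarrow>
        (\<forall>T\<in>A. \<phi> j (\<phi> i T) = \<phi> i (\<phi> j T)))"

section \<open>Reduced expressions\<close>

text \<open>Interchanging the entries in positions \<open>i, i + 1\<close> of the one-line notation of \<open>u\<close> is
  right multiplication by a simple transposition. A word \<open>(\<rho>\<^sub>k, \<dots>, \<rho>\<^sub>1)\<close> is the list read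
  left to right, so its last entry \<open>\<rho>\<^sub>1\<close> acts first.\<close>

definition word_perm :: "nat list \<Rightarrow> nat \<Rightarrow> nat" where
  "word_perm \<rho> = foldr (\<lambda>i u. u \<circ> transpose i (Suc i)) \<rho> id"

lemma "map (word_perm [4, 2, 1, 2, 3]) [1, 2, 3, 4, 5] = [4, 2, 1, 5, 3]"
  by (simp add: word_perm_def transpose_def)

definition inversions :: "(nat \<Rightarrow> nat) \<Rightarrow> nat" where
  "inversions w = card {(i, j). i < j \<and> w j < w i}"

text \<open>\<open>w\<close> is a permutation of \<open>{1..n}\<close>, fixing all other numbers.\<close>

definition reduced_expressions :: "nat \<Rightarrow> (nat \<Rightarrow> nat) \<Rightarrow> nat list set" where
  "reduced_expressions n w =
     {\<rho>. set \<rho> \<subseteq> {1..<n} \<and> length \<rho> = inversions w \<and> word_perm \<rho> = w}"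

text \<open>The lengths are listed from the rightmost run to the leftmost.\<close>

definition word_Des :: "nat list \<Rightarrow> nat list" where
  "word_Des \<rho> = rev (map length (runs (<) \<rho>))"

definition stanley :: "nat \<Rightarrow> (nat \<Rightarrow> nat) \<Rightarrow> power_series" where
  "stanley n w = (\<lambda>m. \<Sum>\<rho>\<in>reduced_expressions n w. fundamental (word_Des \<rho>) m)"

text \<open>Letters are indexed from right to left, starting with 1.\<close>

definition letter :: "nat list \<Rightarrow> nat \<Rightarrow> nat" where
  "letter \<rho> j = \<rho> ! (length \<rho> - j)"

definition set_letter :: "nat \<Rightarrow> nat \<Rightarrow> nat list \<Rightarrow> nat list" where
  "set_letter j x \<rho> = \<rho>[length \<rho> - j := x]"

definition swap_move :: "nat \<Rightarrow> nat list \<Rightarrow> nat list" where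
  "swap_move j \<rho> = set_letter j (letter \<rho> (j + 1)) (set_letter (j + 1) (letter \<rho> j) \<rho>)"

definition braid_move :: "nat \<Rightarrow> nat list \<Rightarrow> nat list" where
  "braid_move j \<rho> =
     set_letter (j - 1) (letter \<rho> j)
       (set_letter j (letter \<rho> (j - 1)) (set_letter (j + 1) (letter \<rho> j) \<rho>))"

definition dd :: "nat \<Rightarrow> nat list \<Rightarrow> nat list" where
  "dd i \<rho> =
     (let a = letter \<rho> (i - 1); b = letter \<rho> i; c = letter \<rho> (i + 1) in
      if c = a \<and> (a = b + 1 \<or> b = a + 1) then braid_move i \<rho>
      else if (a > c \<and> c > b) \<or> (a < c \<and> c < b) then swap_move (i - 1) \<rho>
      else if (c > a \<and> a > b) \<or> (c < a \<and> a < b) then swap_move i \<rho>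
      else \<rho>)"

end

theory Submission
  imports Defs
begin

text \<open>Read \<open>\<rho>\<close> from right to left. The maps \<open>dd i\<close> are then exactly the Coxeter--Knuth moves at
  position \<open>i\<close>, and the orbits of reduced words are described by Edelman--Greene insertion (with
  rows decreasing, to match the descent convention). A word is Coxeter--Knuth equivalent to the
  reading word of its insertion tableau \<open>P\<close>, and \<open>P\<close> is unchanged by a move, because a move on three
  letters inserted into one row yields the same row and either the same three bumped letters or again
  a move of them. Hence orbits are the fibres of \<open>P\<close>. On a fibre the recording tableau, encoded as the
  lattice word of row indices of new boxes, is a bijection onto the standard Young tableaux of the
  shape of \<open>P\<close> that respects descents, so the fundamental functions of an orbit sum to one Schur
  function. Since a window of a reduced word is reduced, this applies to all windows, of whatever
  length. Schur functions are symmetric because their coefficients count chains of horizontal strips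
  of prescribed sizes.\<close>

section \<open>Coxeter--Knuth equivalence\<close>

text \<open>Reducedness is awkward to carry through insertion, since every row and every bumped word
  met on the way would need its own permutation. It is replaced by \<open>good\<close>: no word of
  the equivalence class has a factor \<open>[x, x]\<close>, or \<open>[x, y, x]\<close> with
  \<open>x\<close>, \<open>y\<close> not adjacent numbers. By its form this passes to equivalent
  words and to factors, and it gives row insertion what it needs: a letter that is already present
  has its predecessor as right neighbour. Permutations return only in \<open>reduced_good\<close>.
  Power series are avoided in the same spirit. All descent compositions are run lengths of a list
  with respect to a relation between neighbours, and the coefficient of such a fundamental function
  at a monomial is 0 or 1, according to whether all breaks between runs lie on the block boundaries
  given by the exponents. Equality of functions thus becomes a bijection preserving breaks, and
  symmetry becomes a count of lattice words cut into blocks.\<close>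

inductive ck3 :: "nat list \<Rightarrow> nat list \<Rightarrow> bool" where
  ck3_yxz: "x < y \<Longrightarrow> y < z \<Longrightarrow> ck3 [y, x, z] [y, z, x]"
| ck3_xzy: "x < y \<Longrightarrow> y < z \<Longrightarrow> ck3 [x, z, y] [z, x, y]"
| ck3_braid: "ck3 [x, Suc x, x] [Suc x, x, Suc x]"

definition ck :: "nat list \<Rightarrow> nat list \<Rightarrow> bool" where
  "ck v w \<longleftrightarrow> (\<exists>p q s t. v = p @ s @ q \<and> w = p @ t @ q \<and> (ck3 s t \<or> ck3 t s))"

abbreviation cke :: "nat list \<Rightarrow> nat list \<Rightarrow> bool" where
  "cke \<equiv> ck\<^sup>*\<^sup>*"

text \<open>Either factor makes a word non-reduced: \<open>[x, x]\<close> cancels, and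
  \<open>[x, y, x]\<close> with commuting letters shortens to \<open>[y]\<close>.\<close>

definition bad_factor :: "nat list \<Rightarrow> bool" where
  "bad_factor w \<longleftrightarrow> (\<exists>p q x. w = p @ [x, x] @ q) \<or>
     (\<exists>p q x y. w = p @ [x, y, x] @ q \<and> x \<noteq> Suc y \<and> y \<noteq> Suc x)"

definition good :: "nat list \<Rightarrow> bool" where
  "good w \<longleftrightarrow> (\<forall>v. cke w v \<longrightarrow> \<not> bad_factor v)"

lemma ck_sym: "ck v w \<Longrightarrow> ck w v"
  unfolding ck_def by blast

lemma cke_sym: "cke v w \<Longrightarrow> cke w v"
  by (metis ck_sym sympD sympI symp_rtranclp)

lemma ck_context: "ck v w \<Longrightarrow> ck (p @ v @ q) (p @ w @ q)"
  unfolding ck_def by (metis append.assoc)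

lemma cke_context: "cke v w \<Longrightarrow> cke (p @ v @ q) (p @ w @ q)"
proof (induction rule: rtranclp_induct)
  case base then show ?case by simp
next
  case (step y z) then show ?case using ck_context by (meson rtranclp.rtrancl_into_rtrancl)
qed

lemma cke_Cons: "cke v w \<Longrightarrow> cke (x # v) (x # w)"
  using cke_context[of v w "[x]" "[]"] by simp

lemma cke_append1: "cke v w \<Longrightarrow> cke (v @ q) (w @ q)"
  using cke_context[of v w "[]" q] by simp

lemma cke_append2: "cke v w \<Longrightarrow> cke (p @ v) (p @ w)"
  using cke_context[of v w p "[]"] by simp

lemma ck3_imp_cke: "ck3 s t \<or> ck3 t s \<Longrightarrow> cke (s @ q) (t @ q)"
  unfolding ck_def by (intro r_into_rtranclp exI[of _ "[]"] exI[of _ q] exI[of _ s] exI[of _ t]) auto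

lemma ck3_length: "ck3 s t \<Longrightarrow> length s = 3 \<and> length t = 3"
  by (auto elim!: ck3.cases)

lemma cke_length: "cke v w \<Longrightarrow> length v = length w"
proof (induction rule: rtranclp_induct)
  case (step y z) then show ?case unfolding ck_def using ck3_length by force
qed simp

lemma good_cke: "good v \<Longrightarrow> cke v w \<Longrightarrow> good w"
  unfolding good_def by (meson rtranclp_trans)

lemma bad_factor_context: "bad_factor w \<Longrightarrow> bad_factor (p @ w @ q)"
  unfolding bad_factor_def by (metis append.assoc)

lemma good_factor: "good (p @ w @ q) \<Longrightarrow> good w"
  unfolding good_def using bad_factor_context cke_context by blast

lemma good_append1: "good (p @ q) \<Longrightarrow> good p"
  using good_factor[of "[]" p q] by simp

lemma good_append2: "good (p @ q) \<Longrightarrow> good q"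
  using good_factor[of p q "[]"] by simp

lemma good_Cons: "good (x # q) \<Longrightarrow> good q"
  using good_append2[of "[x]" q] by simp

lemma good_not_bad: "good w \<Longrightarrow> \<not> bad_factor w"
  unfolding good_def by blast

lemma good_sq: "\<not> good (p @ x # x # q)"
  using good_not_bad unfolding bad_factor_def by force

lemma good_xyx: "good (x # y # x # q) \<Longrightarrow> x = Suc y \<or> y = Suc x"
  using good_not_bad[of "x # y # x # q"] unfolding bad_factor_def
  by (metis append.left_neutral append_Cons)

section \<open>Row insertion\<close>

text \<open>Rows are strictly decreasing. A letter already present leaves the row unchanged and bumps
  its right neighbour; in a reduced word this neighbour is its predecessor.\<close>

abbreviation dec :: "nat list \<Rightarrow> bool" where
  "dec \<equiv> sorted_wrt (>)"

fun row_insert :: "nat list \<Rightarrow> nat \<Rightarrow> nat list \<times> nat option" where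
  "row_insert [] x = ([x], None)"
| "row_insert (a # R) x =
    (if x < a then (a # fst (row_insert R x), snd (row_insert R x))
     else if x = a then (a # R, Some (hd R))
     else (x # R, Some a))"

text \<open>The letter \<open>a\<close> passes a row entry because the entry before it lies between
  the two and witnesses the exchange. The head \<open>b\<close> has no such witness on its left, so
  \<open>a\<close> stops right behind it.\<close>

lemma cke_move_left:
  "dec (b # R) \<Longrightarrow> b < a \<Longrightarrow> cke (b # R @ [a]) (b # a # R)"
proof (induction R arbitrary: b)
  case (Cons c R)
  have "cke (c # R @ [a]) (c # a # R)" using Cons by simp
  then have "cke (b # c # R @ [a]) (b # c # a # R)" by (rule cke_Cons)
  moreover have "cke (b # c # a # R) (b # a # c # R)"
    using ck3_imp_cke[of "[b, c, a]" "[b, a, c]" R] ck3_yxz[of c b a] Cons.prems by simp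
  ultimately show ?case by simp
qed simp

text \<open>Moving the second \<open>a\<close> left until it stands behind the head \<open>b\<close>
  of \<open>R\<close> creates the factor \<open>[a, b, a]\<close>, which in a good word must be a
  braid; an empty \<open>R\<close> would leave the factor \<open>[a, a]\<close>. This keeps
  \<open>row_insert\<close> away from the unspecified value \<open>hd []\<close>.\<close>

lemma good_present:
  assumes "dec (a # R)" "good (a # R @ a # q)"
  shows "R \<noteq> [] \<and> a = Suc (hd R)"
proof (cases R)
  case Nil then show ?thesis using assms good_sq[of "[]"] by simp
next
  case (Cons b R')
  have "cke (b # R' @ [a]) (b # a # R')" using cke_move_left assms Cons by simp
  then have "cke (a # R @ a # q) (a # b # a # R' @ q)"
    using Cons cke_context[of "b # R' @ [a]" "b # a # R'" "[a]" q] by simp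
  then have "good (a # b # a # R' @ q)" using assms(2) good_cke by blast
  then show ?thesis using good_xyx[of a b] assms(1) Cons by fastforce
qed

lemma row_insert_None:
  "row_insert R x = (R', None) \<Longrightarrow> R' = R @ [x] \<and> (\<forall>a\<in>set R. x < a)"
  by (induction R arbitrary: R') (auto split: if_splits intro!: prod_eqI simp: prod_eq_iff)

text \<open>The bumped letter \<open>y\<close> has to travel to the front of the row. It starts by
  \<open>cke_move_left\<close> where \<open>x\<close> replaces an entry, or by a braid where
  \<open>x\<close> is already present; it then passes each larger entry with the right neighbour of
  that entry in the new row as witness.\<close>

lemma row_insert_Some:
  assumes "dec R" "good (R @ [x])" "row_insert R x = (R', Some y)"
  shows "y < x \<and> y \<in> set R \<and> dec R' \<and> set R' \<subseteq> insert x (set R) \<and> x \<in> set R' \<and>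
    length R' = length R \<and> cke (R @ [x]) (y # R')"
  using assms
proof (induction R arbitrary: R')
  case (Cons a R)
  consider "x < a" | "x = a" | "a < x" by linarith
  then show ?case
  proof cases
    case 1
    then obtain R1 where R1: "row_insert R x = (R1, Some y)" "R' = a # R1"
      using Cons.prems by (cases "row_insert R x") auto
    have IH: "y < x \<and> y \<in> set R \<and> dec R1 \<and> set R1 \<subseteq> insert x (set R) \<and> x \<in> set R1 \<and>
        length R1 = length R \<and> cke (R @ [x]) (y # R1)"
      using Cons.IH[OF _ _ R1(1)] Cons.prems good_Cons by auto
    obtain h R2 where R2: "R1 = h # R2" using IH by (cases R1) auto
    have h: "y < h" "h < a" using IH R2 1 Cons.prems by auto
    have "cke (a # R @ [x]) (a # y # h # R2)" using IH R2 cke_Cons by simp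
    moreover have "cke (a # y # h # R2) (y # a # h # R2)"
      using ck3_imp_cke[of "[a, y, h]" "[y, a, h]" R2] ck3_xzy[of y h a] h by simp
    ultimately have "cke (a # R @ [x]) (y # R')" using R1 R2 by simp
    then show ?thesis using IH R1 1 Cons.prems by auto
  next
    case 2
    then obtain R1 where R1: "R = y # R1" "a = Suc y"
      using good_present[of a R "[]"] Cons.prems by (cases R) auto
    have "cke (y # R1 @ [a]) (y # a # R1)"
      using Cons.prems R1 by (intro cke_move_left) auto
    then have "cke (a # y # R1 @ [a]) (a # y # a # R1)" by (rule cke_Cons)
    moreover have "cke (a # y # a # R1) (y # a # y # R1)"
      using ck3_imp_cke[of "[a, y, a]" "[y, a, y]" R1] ck3_braid[of y] R1 by simp
    ultimately have "cke (a # y # R1 @ [a]) (y # a # y # R1)" by simp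
    then show ?thesis using 2 R1 Cons.prems by auto
  next
    case 3
    moreover have "\<forall>b\<in>set R. b < x"
      using 3 Cons.prems(1) by (metis less_trans sorted_wrt.simps(2))
    ultimately show ?thesis using cke_move_left[of a R x] Cons.prems by auto
  qed
qed simp

text \<open>The suffix \<open>q\<close> stands for letters still to be inserted; goodness of the new
  row followed by \<open>q\<close> permits the next insertion.\<close>

lemma row_insert_props:
  assumes "dec R" "good (R @ x # q)"
  shows "dec (fst (row_insert R x)) \<and> good (fst (row_insert R x) @ q) \<and>
    set (fst (row_insert R x)) \<subseteq> insert x (set R) \<and>
    cke (R @ [x]) (case_option [] (\<lambda>y. [y]) (snd (row_insert R x)) @ fst (row_insert R x))"
proof (cases "row_insert R x")
  case (Pair R' z)
  show ?thesis
  proof (cases z)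
    case None
    then have "R' = R @ [x]" "\<forall>a\<in>set R. x < a" using row_insert_None Pair by auto
    then show ?thesis using assms None Pair by (auto simp: sorted_wrt_append)
  next
    case (Some y)
    have "good (R @ [x])" using assms good_append1[of "R @ [x]" q] by simp
    then have *: "dec R'" "set R' \<subseteq> insert x (set R)" "cke (R @ [x]) (y # R')"
      using row_insert_Some[of R x R' y] assms Pair Some by blast+
    then have "cke (R @ x # q) (y # R' @ q)" using cke_append1[of "R @ [x]" "y # R'" q] by simp
    then have "good (R' @ q)" using assms good_cke good_Cons by blast
    then show ?thesis using * Pair Some by simp
  qed
qed

lemma row_insert_snd:
  assumes "dec R" "good (R @ x # q)" "snd (row_insert R x) = Some y"
  shows "y < x \<and> y \<in> set R"
  using row_insert_Some[of R x "fst (row_insert R x)" y] assms good_append1[of "R @ [x]" q]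
  by (simp add: prod_eq_iff)

text \<open>Row bumping for a descent: in a decreasing row the smaller letter acts further right
  than \<open>x\<close> did, so it displaces something smaller, and it can displace a letter only if
  \<open>x\<close> was not appended at the end.\<close>

lemma row_insert_two_dec:
  assumes "dec R" "good (R @ x # y # q)" "y < x"
    "snd (row_insert (fst (row_insert R x)) y) = Some b"
  shows "\<exists>a>b. snd (row_insert R x) = Some a"
  using assms
proof (induction R)
  case (Cons a R)
  consider "x < a" | "x = a" | "a < x" by linarith
  then show ?case
  proof cases
    case 1 then show ?thesis using Cons good_Cons[of a] by auto
  next
    case 2
    have h: "R \<noteq> [] \<and> a = Suc (hd R)" using good_present[of a R "y # q"] Cons.prems 2 by auto
    then obtain c R' where R: "R = c # R'" by (cases R) auto
    have g: "good (c # R' @ y # q)"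
      using row_insert_props[of "a # R" x "y # q"] Cons.prems 2 R good_Cons[of a] by auto
    \<comment> \<open>Here \<open>x\<close> bumps \<open>c\<close> without removing it, and
      \<open>y < x = Suc c\<close> leaves only \<open>y = c\<close> or \<open>y < c\<close>.\<close>
    show ?thesis
    proof (cases "y = c")
      case True
      then show ?thesis using 2 h R good_present[of c R' q] g Cons.prems by auto
    next
      case False
      then have "y < c" using R h Cons.prems 2 by auto
      then show ?thesis using row_insert_snd[of R' y q b] g good_Cons[of c] Cons.prems 2 R by auto
    qed
  next
    case 3
    then have g: "good (R @ y # q)"
      using row_insert_props[of "a # R" x "y # q"] Cons.prems good_Cons[of x] by auto
    then show ?thesis using row_insert_snd[of R y q b] 3 Cons.prems by auto
  qed
qed simp

text \<open>Row bumping for an ascent: the row now contains \<open>x\<close>, so the larger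
  \<open>y\<close> cannot be appended. It acts weakly left of \<open>x\<close> and therefore
  displaces something larger.\<close>

lemma row_insert_two_inc:
  assumes "dec R" "good (R @ x # y # q)" "x < y"
  shows "\<exists>b. snd (row_insert (fst (row_insert R x)) y) = Some b \<and>
    (\<forall>a. snd (row_insert R x) = Some a \<longrightarrow> a < b)"
  using assms
proof (induction R)
  case (Cons a R)
  consider "x < a" | "x = a" | "a < x" by linarith
  then show ?case
  proof cases
    case 1
    show ?thesis
    proof (cases "y < a")
      case True then show ?thesis using 1 Cons good_Cons[of a] by auto
    next
      case False
      have g: "good (R @ x # y # q)" using Cons.prems good_Cons[of a] by simp
      have o: "snd (row_insert R x) = Some z \<Longrightarrow> z < x" for z
        using row_insert_snd[of R x "y # q" z] g Cons.prems by simp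
      \<comment> \<open>If \<open>y\<close> equals the head \<open>a\<close>, it bumps the first
        entry of the new tail, so that entry has to be compared with the letter bumped by
        \<open>x\<close>.\<close>
      have o2: "x \<le> hd (fst (row_insert R x))"
        using 1 by (cases R) auto
      show ?thesis
        using o o2 1 False by (auto dest: order.strict_trans2)
    qed
  next
    case 2
    then show ?thesis using good_present[of a R "y # q"] Cons.prems by (cases R) auto
  next
    case 3
    then show ?thesis using Cons.prems by auto
  qed
qed simp

section \<open>Three-letter moves pushed through a single row\<close>

fun row_insert_word :: "nat list \<Rightarrow> nat list \<Rightarrow> nat list \<times> nat list" where
  "row_insert_word R [] = (R, [])"
| "row_insert_word R (x # w) =
    (let (R1, z) = row_insert R x; (R2, v) = row_insert_word R1 w
     in (R2, case z of None \<Rightarrow> v | Some y \<Rightarrow> y # v))"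

lemma row_insert_hd_gt:
  "dec R \<Longrightarrow> \<forall>b\<in>set R. b < a \<Longrightarrow> R \<noteq> [] \<Longrightarrow> row_insert R a = (a # tl R, Some (hd R))"
  by (cases R) auto

lemma row_insert_hd_ge:
  "fst (row_insert R x) \<noteq> [] \<and> x \<le> hd (fst (row_insert R x))"
  by (cases R) auto

text \<open>The induction hypothesis covers the case of three letters below the head. Otherwise
  \<open>z\<close>, and possibly \<open>y\<close>, acts at the head, while \<open>x\<close> goes
  into the tail and bumps the smallest of the three bumped letters. The bumped words then differ by
  an exchange of the same kind, or coincide if \<open>x\<close> bumps nothing.\<close>

lemma row_insert_word_yxz:
  assumes "dec R" "good (R @ [y, x, z])" "good (R @ [y, z, x])" "x < y" "y < z"
    "row_insert_word R [y, x, z] = (R1, v)" "row_insert_word R [y, z, x] = (R2, w)"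
  shows "R1 = R2 \<and> (v = w \<or> ck3 v w)"
  using assms
proof (induction R arbitrary: R1 R2)
  case Nil then show ?case by auto
next
  case (Cons a R)
  obtain S1 y1 where y1: "row_insert R y = (S1, y1)" by fastforce
  obtain S2 x2 where x2: "row_insert S1 x = (S2, x2)" by fastforce
  obtain S x' where x': "row_insert R x = (S, x')" by fastforce
  have g1: "good (R @ [y, x])"
    using Cons.prems(2) good_append1[of "R @ [y, x]" "[z]"] good_Cons[of a] by simp
  show ?case
  proof (cases "z < a")
    case True
    obtain S3 z3 where z3: "row_insert S2 z = (S3, z3)" by fastforce
    obtain S4 z4 where z4: "row_insert S1 z = (S4, z4)" by fastforce
    obtain S5 x5 where x5: "row_insert S4 x = (S5, x5)" by fastforce
    have "good (R @ [y, x, z])" "good (R @ [y, z, x])" using Cons.prems good_Cons[of a] by auto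
    then show ?thesis using Cons.IH[of "tl R1" "tl R2"] Cons.prems True y1 x2 z3 z4 x5 by auto
  next
    case False
    consider "y < a" "z = a" | "y < a" "a < z" | "y = a" | "a < y" using False by linarith
    then show ?thesis
    proof cases
      case 1
      have "dec (a # S1)" "good (a # S1 @ [z, x])"
        using row_insert_props[of "a # R" y "[z, x]"] Cons.prems y1 1 by auto
      then have h1: "Suc (hd S1) = a" using good_present[of a S1 "[x]"] 1 by auto
      have "dec (a # S1)" "good (a # S1 @ [x, z])"
        using row_insert_props[of "a # R" y "[x, z]"] Cons.prems y1 1 by auto
      then have "dec (a # S2)" "good (a # S2 @ [z])"
        using row_insert_props[of "a # S1" x "[z]"] Cons.prems x2 1 by auto
      then have h2: "Suc (hd S2) = a" using good_present[of a S2 "[]"] 1 by auto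
      have o: "y1 = Some c \<Longrightarrow> c < y" for c
        using row_insert_snd[of R y "[x]" c] y1 g1 Cons.prems by auto
      have o2: "x2 = Some b \<Longrightarrow> \<exists>c>b. y1 = Some c" for b
        using row_insert_two_dec[of R y x "[]" b] y1 x2 g1 Cons.prems by auto
      show ?thesis using Cons.prems 1 y1 x2 o o2 h1 h2
        by (cases y1; cases x2) (auto intro!: ck3_yxz)
    next
      case 2
      have o: "y1 = Some c \<Longrightarrow> c < a" for c
        using row_insert_snd[of R y "[x]" c] y1 g1 Cons.prems by auto
      have o2: "x2 = Some b \<Longrightarrow> \<exists>c>b. y1 = Some c" for b
        using row_insert_two_dec[of R y x "[]" b] y1 x2 g1 Cons.prems by auto
      show ?thesis using Cons.prems 2 y1 x2 o o2
        by (cases y1; cases x2) (auto intro!: ck3_yxz)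
    next
      case 3
      have h: "Suc (hd R) = a"
        using good_present[of a R "[x, z]"] Cons.prems 3 by auto
      have "good (a # R @ [x, z])"
        using row_insert_props[of "a # R" y "[x, z]"] Cons.prems 3 by auto
      then have g: "good (R @ [x, z])" by (rule good_Cons)
      have o: "x' = Some c \<Longrightarrow> c < x" for c
        using row_insert_snd[of R x "[z]" c] x' g Cons.prems by auto
      show ?thesis using Cons.prems 3 x' o h
        by (cases x') (auto intro!: ck3_yxz)
    next
      case 4
      have "good (y # R @ [x, z])"
        using row_insert_props[of "a # R" y "[x, z]"] Cons.prems 4 by auto
      then have g: "good (R @ [x, z])" by (rule good_Cons)
      have o: "x' = Some c \<Longrightarrow> c < a" for c
        using row_insert_snd[of R x "[z]" c] x' g Cons.prems by auto
      show ?thesis using Cons.prems 4 x' o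
        by (cases x') (auto intro!: ck3_yxz)
    qed
  qed
qed

text \<open>The kind of move may change. If \<open>x\<close> equals the head \<open>a\<close>, the
  bumped words are \<open>[a-1, a, a-1]\<close> and \<open>[a, a-1, a]\<close>, so a braid arises.
  If \<open>x\<close> exceeds the head \<open>a\<close> and the tail starts with \<open>r\<close>,
  they are \<open>[a, x, r]\<close> and \<open>[a, r, x]\<close>: an exchange witnessed by the first
  letter, in the opposite direction. Hence the symmetric conclusion.\<close>

lemma row_insert_word_xzy:
  assumes "dec R" "good (R @ [x, z, y])" "good (R @ [z, x, y])" "x < y" "y < z"
    "row_insert_word R [x, z, y] = (R1, v)" "row_insert_word R [z, x, y] = (R2, w)"
  shows "R1 = R2 \<and> (v = w \<or> ck3 v w \<or> ck3 w v)"
  using assms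
proof (induction R arbitrary: R1 R2)
  case Nil then show ?case by auto
next
  case (Cons a R)
  obtain S x1 where x1: "row_insert R x = (S, x1)" by fastforce
  obtain S2 y2 where y2: "row_insert S y = (S2, y2)" by fastforce
  show ?case
  proof (cases "z < a")
    case True
    obtain S3 z3 where z3: "row_insert S z = (S3, z3)" by fastforce
    obtain S4 y4 where y4: "row_insert S3 y = (S4, y4)" by fastforce
    obtain S5 z5 where z5: "row_insert R z = (S5, z5)" by fastforce
    obtain S6 x6 where x6: "row_insert S5 x = (S6, x6)" by fastforce
    obtain S7 y7 where y7: "row_insert S6 y = (S7, y7)" by fastforce
    have "good (R @ [x, z, y])" "good (R @ [z, x, y])" using Cons.prems good_Cons[of a] by auto
    then show ?thesis using Cons.IH[of "tl R1" "tl R2"] Cons.prems True x1 z3 y4 z5 x6 y7 by auto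
  next
    case False
    consider "y < a" "z = a" | "y < a" "a < z" | "x < a" "a \<le> y" | "x = a" | "a < x"
      using False by linarith
    then show ?thesis
    proof cases
      case 1
      have "dec (a # S)" "good (a # S @ [z, y])"
        using row_insert_props[of "a # R" x "[z, y]"] Cons.prems x1 1 by auto
      then have h1: "Suc (hd S) = a" using good_present[of a S "[y]"] 1 by auto
      have h2: "Suc (hd R) = a" using good_present[of a R "[x, y]"] Cons.prems 1 by auto
      have "good (a # R @ [x, y])"
        using row_insert_props[of "a # R" z "[x, y]"] Cons.prems 1 by auto
      then have g: "good (R @ [x, y])" by (rule good_Cons)
      then obtain b where b: "y2 = Some b" "\<forall>c. x1 = Some c \<longrightarrow> c < b"
        using row_insert_two_inc[of R x y "[]"] x1 y2 Cons.prems by auto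
      have "dec S" "good (S @ [y])"
        using row_insert_props[of R x "[y]"] Cons.prems x1 g by auto
      then have "b < y" using row_insert_snd[of S y "[]" b] y2 b by auto
      then show ?thesis using Cons.prems 1 x1 y2 b h1 h2
        by (cases x1) (auto intro!: ck3_xzy)
    next
      case 2
      have "good (z # R @ [x, y])"
        using row_insert_props[of "a # R" z "[x, y]"] Cons.prems 2 by auto
      then have g: "good (R @ [x, y])" by (rule good_Cons)
      then obtain b where b: "y2 = Some b" "\<forall>c. x1 = Some c \<longrightarrow> c < b"
        using row_insert_two_inc[of R x y "[]"] x1 y2 Cons.prems by auto
      have "dec S" "good (S @ [y])"
        using row_insert_props[of R x "[y]"] Cons.prems x1 g by auto
      then have "b < y" using row_insert_snd[of S y "[]" b] y2 b by auto
      then show ?thesis using Cons.prems 2 x1 y2 b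
        by (cases x1) (auto intro!: ck3_xzy)
    next
      case 3
      have "good (z # R @ [x, y])"
        using row_insert_props[of "a # R" z "[x, y]"] Cons.prems 3 by auto
      then have g: "good (R @ [x, y])" by (rule good_Cons)
      have S: "dec S" "set S \<subseteq> insert x (set R)"
        using row_insert_props[of R x "[y]"] Cons.prems x1 g by auto
      have n: "S \<noteq> []" "x \<le> hd S" using row_insert_hd_ge[of R x] x1 by auto
      have lt: "\<forall>b\<in>set S. b < a" using S Cons.prems 3 by auto
      have o: "x1 = Some c \<Longrightarrow> c < x" for c
        using row_insert_snd[of R x "[y]" c] x1 g Cons.prems by auto
      have "row_insert S y = (y # tl S, Some (hd S))"
        using row_insert_hd_gt[of S y] S n lt 3 by fastforce
      then show ?thesis using Cons.prems 3 x1 o lt n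
        by (cases x1) (auto intro!: ck3_xzy dest: order.strict_trans2)
    next
      case 4
      then obtain R' where R': "R = hd R # R'" "Suc (hd R) = a"
        using good_present[of a R "[z, y]"] Cons.prems by (cases R) auto
      then show ?thesis using Cons.prems 4 ck3_braid[of "hd R"]
        by (cases R) auto
    next
      case 5
      then show ?thesis using Cons.prems by (cases R) (auto intro!: ck3_yxz)
    qed
  qed
qed

text \<open>If the head is \<open>x\<close> or \<open>Suc x\<close>, goodness supplies the
  predecessors in the row that make the bumped words a braid again. If the head \<open>a\<close> is
  below \<open>x\<close> and the tail starts with \<open>r\<close>, the braid turns into the
  exchange of \<open>[a, x, r]\<close> and \<open>[a, r, x]\<close>.\<close>

lemma row_insert_word_braid:
  assumes "dec R" "good (R @ [x, Suc x, x])" "good (R @ [Suc x, x, Suc x])"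
    "row_insert_word R [x, Suc x, x] = (R1, v)" "row_insert_word R [Suc x, x, Suc x] = (R2, w)"
  shows "R1 = R2 \<and> (v = w \<or> ck3 v w \<or> ck3 w v)"
  using assms
proof (induction R arbitrary: R1 R2)
  case Nil then show ?case by auto
next
  case (Cons a R)
  consider "Suc x < a" | "Suc x = a" | "x = a" | "a < x" by linarith
  then show ?case
  proof cases
    case 1
    obtain S1 z1 where z1: "row_insert R x = (S1, z1)" by fastforce
    obtain S2 z2 where z2: "row_insert S1 (Suc x) = (S2, z2)" by fastforce
    obtain S3 z3 where z3: "row_insert S2 x = (S3, z3)" by fastforce
    obtain S4 z4 where z4: "row_insert R (Suc x) = (S4, z4)" by fastforce
    obtain S5 z5 where z5: "row_insert S4 x = (S5, z5)" by fastforce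
    obtain S6 z6 where z6: "row_insert S5 (Suc x) = (S6, z6)" by fastforce
    have "good (R @ [x, Suc x, x])" "good (R @ [Suc x, x, Suc x])" using Cons.prems good_Cons[of a] by auto
    then show ?thesis using Cons.IH[of "tl R1" "tl R2"] Cons.prems 1 z1 z2 z3 z4 z5 z6 by auto
  next
    case 2
    then obtain R' where R': "R = x # R'"
      using good_present[of a R "[x, Suc x]"] Cons.prems by (cases R) auto
    then have "R' \<noteq> [] \<and> x = Suc (hd R')"
      using good_present[of x R' "[Suc x, x]"] Cons.prems good_Cons[of a] by auto
    then show ?thesis using Cons.prems R' 2 ck3_braid[of "hd R'"] by (cases R') auto
  next
    case 3
    then obtain R' where R': "R = hd R # R'" "Suc (hd R) = a"
      using good_present[of a R "[Suc x, x]"] Cons.prems by (cases R) auto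
    then show ?thesis using Cons.prems 3 ck3_braid[of "hd R"] by (cases R) auto
  next
    case 4
    then show ?thesis using Cons.prems by (cases R) (auto intro!: ck3_yxz)
  qed
qed

lemma row_insert_word_ck3:
  assumes "dec R" "good (R @ s)" "ck3 s t \<or> ck3 t s"
    "row_insert_word R s = (R1, v)" "row_insert_word R t = (R2, w)"
  shows "R1 = R2 \<and> (v = w \<or> ck3 v w \<or> ck3 w v)"
proof -
  have *: "R1' = R2' \<and> (v' = w' \<or> ck3 v' w' \<or> ck3 w' v')"
    if "ck3 s' t'" "good (R @ s')" "good (R @ t')" "row_insert_word R s' = (R1', v')"
      "row_insert_word R t' = (R2', w')" for s' t' R1' R2' v' w'
    using that(1)
  proof (cases rule: ck3.cases)
    case (ck3_yxz x y z)
    show ?thesis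
      using row_insert_word_yxz[OF assms(1) _ _ ck3_yxz(3,4)] that(2-5)
      unfolding ck3_yxz(1,2) by metis
  next
    case (ck3_xzy x y z)
    show ?thesis
      using row_insert_word_xzy[OF assms(1) _ _ ck3_xzy(3,4)] that(2-5)
      unfolding ck3_xzy(1,2) by metis
  next
    case (ck3_braid x)
    show ?thesis
      using row_insert_word_braid[OF assms(1)] that(2-5) unfolding ck3_braid(1,2) by metis
  qed
  have "cke (s @ []) (t @ [])" using assms(3) by (rule ck3_imp_cke)
  then have "good (R @ t)" using assms(2) cke_append2[of s t R] good_cke by simp
  with assms(3) show ?thesis
    using *[OF _ assms(2) _ assms(4,5)] *[OF _ _ assms(2) assms(5,4)] by blast
qed

text \<open>This is how the word handed on to the next row inherits goodness: it is a prefix of an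
  equivalent word.\<close>

lemma row_insert_word_cke:
  assumes "dec R" "good (R @ w)"
  shows "dec (fst (row_insert_word R w)) \<and>
    cke (R @ w) (snd (row_insert_word R w) @ fst (row_insert_word R w))"
  using assms
proof (induction w arbitrary: R)
  case (Cons x w)
  obtain R' z where R': "row_insert R x = (R', z)" by fastforce
  let ?o = "case_option [] (\<lambda>y. [y]) z"
  have p: "dec R'" "good (R' @ w)" "cke (R @ [x]) (?o @ R')"
    using row_insert_props[of R x w] Cons.prems R' by auto
  have "cke (R @ x # w) (?o @ R' @ w)" using cke_append1[OF p(3), of w] by simp
  also have "cke \<dots> (?o @ snd (row_insert_word R' w) @ fst (row_insert_word R' w))"
    using Cons.IH[OF p(1,2)] by (intro cke_append2) simp
  finally show ?case using Cons.IH[OF p(1,2)] R' by (auto split: prod.splits option.splits)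
qed simp

lemma good_bumped:
  assumes "dec R" "good (p @ R @ [x])" "row_insert R x = (R', Some y)"
  shows "good (p @ [y])"
proof -
  have "good (R @ [x])" using assms(2) by (rule good_append2)
  then have "cke (R @ [x]) (y # R')" using row_insert_Some assms by blast
  then have "good (p @ y # R')" using assms(2) good_cke cke_append2 by blast
  then show ?thesis using good_append1[of "p @ [y]" R'] by simp
qed

section \<open>Tableau insertion\<close>

fun tab_insert :: "nat list list \<Rightarrow> nat \<Rightarrow> nat list list \<times> nat" where
  "tab_insert [] x = ([[x]], 0)"
| "tab_insert (R # T) x = (case row_insert R x of
     (R', None) \<Rightarrow> (R' # T, 0)
   | (R', Some y) \<Rightarrow> (R' # fst (tab_insert T y), Suc (snd (tab_insert T y))))"

fun insert_word :: "nat list list \<Rightarrow> nat list \<Rightarrow> nat list list" where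
  "insert_word T [] = T"
| "insert_word T (x # w) = insert_word (fst (tab_insert T x)) w"

fun record_word :: "nat list list \<Rightarrow> nat list \<Rightarrow> nat list" where
  "record_word T [] = []"
| "record_word T (x # w) = snd (tab_insert T x) # record_word (fst (tab_insert T x)) w"

text \<open>The head of the list is the bottom row, and a bumped letter leaves its row on the left.
  Reading upper rows first puts it directly behind the row that receives it.\<close>

definition reading :: "nat list list \<Rightarrow> nat list" where
  "reading T = concat (rev T)"

fun first_row :: "nat list list \<Rightarrow> nat list" where
  "first_row [] = []"
| "first_row (R # T) = R"

fun dom_row :: "nat list \<Rightarrow> nat list \<Rightarrow> bool" where
  "dom_row R [] = True"
| "dom_row [] (b # S) = False"
| "dom_row (a # R) (b # S) = (b < a \<and> dom_row R S)"

primrec tableau :: "nat list list \<Rightarrow> bool" where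
  "tableau [] = True"
| "tableau (R # T) = (R \<noteq> [] \<and> dec R \<and> dom_row R (first_row T) \<and> tableau T)"

definition row_len :: "nat list list \<Rightarrow> nat \<Rightarrow> nat" where
  "row_len T r = (if r < length T then length (T ! r) else 0)"

lemma reading_simps [simp]: "reading [] = []" "reading (R # T) = reading T @ R"
  by (auto simp: reading_def)

lemma row_len_simps [simp]:
  "row_len [] r = 0" "row_len (R # T) 0 = length R" "row_len (R # T) (Suc r) = row_len T r"
  by (auto simp: row_len_def)

lemma row_len_0: "row_len T 0 = length (first_row T)"
  by (cases T) auto

lemma dom_row_length: "dom_row R S \<Longrightarrow> length S \<le> length R"
  by (induction R S rule: dom_row.induct) auto

lemma row_len_antimono: "tableau T \<Longrightarrow> row_len T (Suc r) \<le> row_len T r"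
proof (induction T arbitrary: r)
  case (Cons R T) then show ?case
    by (cases r) (auto simp: row_len_0 dom_row_length)
qed simp

lemma row_insert_length:
  "length (fst (row_insert R x)) = length R + (if snd (row_insert R x) = None then 1 else 0)"
  by (induction R) auto

lemma row_insert_nonempty: "fst (row_insert R x) \<noteq> []"
  by (cases R) auto

lemma dom_row_insert1: "dom_row R S \<Longrightarrow> dom_row (fst (row_insert R x)) S"
proof (induction R arbitrary: S)
  case Nil then show ?case by (cases S) auto
next
  case (Cons a R) then show ?case by (cases S) auto
qed

lemma dom_row_insert2: "dom_row R (fst (row_insert S y)) \<Longrightarrow> dom_row R S"
proof (induction S arbitrary: R)
  case (Cons a S) then show ?case by (cases R) (auto split: if_splits)
qed simp

text \<open>From the column where \<open>x\<close> acts onwards, the entries of \<open>S\<close> are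
  at most \<open>y\<close>. So \<open>y\<close> acts in \<open>S\<close> weakly further left, in
  columns where \<open>R'\<close> has entries at least \<open>x\<close>, which exceed
  \<open>y\<close>.\<close>

lemma dom_row_insert:
  assumes "dec R" "good (R @ [x])" "dom_row R S" "row_insert R x = (R', Some y)"
  shows "dom_row R' (fst (row_insert S y))"
  using assms
proof (induction R arbitrary: S R')
  case (Cons a R)
  consider "x < a" | "x = a" | "a < x" by linarith
  then show ?case
  proof cases
    case 1
    then obtain R1 where R1: "row_insert R x = (R1, Some y)" "R' = a # R1"
      using Cons.prems by (cases "row_insert R x") auto
    have g: "good (R @ [x])" using Cons.prems good_Cons[of a] by simp
    then have "y \<in> set R" using row_insert_Some[of R x R1 y] Cons.prems R1 by simp
    then have "y < a" using Cons.prems by auto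
    then show ?thesis
      using R1 Cons.IH[OF _ g _ R1(1)] Cons.prems dom_row_insert1[of R _ x] by (cases S) auto
  next
    case 2
    then have "R \<noteq> []" "a = Suc (hd R)" using good_present[of a R "[]"] Cons.prems by auto
    then show ?thesis using 2 Cons.prems by (cases S) auto
  next
    case 3
    then show ?thesis using Cons.prems by (cases S) auto
  qed
qed simp

lemma first_row_tab_insert: "first_row (fst (tab_insert T x)) = fst (row_insert (first_row T) x)"
  by (cases T) (auto split: prod.splits option.splits)

lemma tab_insert_props:
  assumes "tableau T" "good (reading T @ [x])"
  shows "tableau (fst (tab_insert T x)) \<and> cke (reading T @ [x]) (reading (fst (tab_insert T x)))"
  using assms
proof (induction T arbitrary: x)
  case (Cons R T)
  obtain R' z where R': "row_insert R x = (R', z)" by fastforce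
  have g: "good (R @ [x])" using Cons.prems good_append2[of "reading T"] by simp
  show ?case
  proof (cases z)
    case None
    then show ?thesis
      using R' row_insert_None[of R x R'] row_insert_props[of R x "[]"] dom_row_insert1[of R _ x]
         Cons.prems g by auto
  next
    case (Some y)
    have p: "dec R'" "cke (R @ [x]) (y # R')" "length R' = length R"
      using row_insert_Some[of R x R' y] R' Some Cons.prems g by auto
    have c: "cke (reading T @ R @ [x]) ((reading T @ [y]) @ R')"
      using cke_append2[OF p(2), of "reading T"] by simp
    then have "good ((reading T @ [y]) @ R')" using Cons.prems good_cke by simp
    then have "good (reading T @ [y])" by (rule good_append1)
    then have IH: "tableau (fst (tab_insert T y))"
        "cke (reading T @ [y]) (reading (fst (tab_insert T y)))"
      using Cons by auto
    have "dom_row R' (first_row (fst (tab_insert T y)))"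
      unfolding first_row_tab_insert using dom_row_insert[OF _ g _ R'[unfolded Some]] Cons.prems
      by simp
    then show ?thesis using IH p R' Some c Cons.prems cke_append1[OF IH(2), of R'] by auto
  qed
qed simp

lemma tab_insert_row_len:
  "row_len (fst (tab_insert T x)) =
     (row_len T)(snd (tab_insert T x) := Suc (row_len T (snd (tab_insert T x))))"
proof (induction T arbitrary: x)
  case Nil then show ?case by (auto simp: row_len_def)
next
  case (Cons R T)
  show ?case
  proof
    fix r
    show "row_len (fst (tab_insert (R # T) x)) r =
     ((row_len (R # T))(snd (tab_insert (R # T) x) := Suc (row_len (R # T) (snd (tab_insert (R # T) x))))) r"
      using row_insert_length[of R x] Cons
      by (cases r) (auto split: prod.splits option.splits)
  qed
qed

text \<open>Either one of the two letters ends in the first row, and the bumping lemmas tell which,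
  or both bump, and the bumped letters compare in the same way as \<open>x\<close> and
  \<open>y\<close>.\<close>

lemma tab_insert_two:
  assumes "tableau T" "good (reading T @ [x, y])"
  shows "snd (tab_insert T x) < snd (tab_insert (fst (tab_insert T x)) y) \<longleftrightarrow> x < y"
  using assms
proof (induction T arbitrary: x y)
  case Nil
  then show ?case using good_sq[of "[]" x "[]"] by (auto simp: not_less)
next
  case (Cons R T)
  obtain R1 a where R1: "row_insert R x = (R1, a)" by fastforce
  obtain R2 b where R2: "row_insert R1 y = (R2, b)" by fastforce
  have g: "good (R @ [x, y])" using Cons.prems good_append2[of "reading T"] by simp
  have "x \<noteq> y" using g good_sq[of R x "[]"] by auto
  show ?case
  proof (cases "a = None \<or> b = None")
    case True
    then show ?thesis
      using row_insert_two_inc[of R x y "[]"] row_insert_two_dec[of R x y "[]"] R1 R2 g Cons.prems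
        \<open>x \<noteq> y\<close> by (cases "x < y"; cases a; cases b) auto
  next
    case False
    then obtain c d where cd: "a = Some c" "b = Some d" by auto
    have w: "row_insert_word R [x, y] = (R2, [c, d])" using R1 R2 cd by simp
    have "cke (R @ [x, y]) ([c, d] @ R2)" using row_insert_word_cke[of R "[x, y]"] w g Cons.prems by simp
    then have "cke (reading T @ R @ [x, y]) (reading T @ [c, d] @ R2)" by (rule cke_append2)
    then have "good ((reading T @ [c, d]) @ R2)" using Cons.prems good_cke by simp
    then have "good (reading T @ [c, d])" by (rule good_append1)
    then have "snd (tab_insert T c) < snd (tab_insert (fst (tab_insert T c)) d) \<longleftrightarrow> c < d"
      using Cons by simp
    moreover have "c < d \<longleftrightarrow> x < y"
      using row_insert_two_inc[of R x y "[]"] row_insert_two_dec[of R x y "[]" d] R1 R2 g Cons.prems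
        \<open>x \<noteq> y\<close> cd by (cases "x < y") auto
    ultimately show ?thesis using R1 R2 cd by simp
  qed
qed

subsection \<open>Invariance of the insertion tableau\<close>

text \<open>A row influences the rows above it only through the letters it bumps, so it may absorb
  the whole word before they are touched. This turns an induction over letters into one over
  rows.\<close>

lemma insert_word_Cons:
  "insert_word (R # T) w = fst (row_insert_word R w) # insert_word T (snd (row_insert_word R w))"
  by (induction w arbitrary: R T) (auto split: prod.splits option.splits)

lemma insert_word_append: "insert_word T (v @ w) = insert_word (insert_word T v) w"
  by (induction v arbitrary: T) auto

lemma insert_word_ck3:
  assumes "tableau T" "good (reading T @ s)" "ck3 s t \<or> ck3 t s"
  shows "insert_word T s = insert_word T t"
  using assms
proof (induction T arbitrary: s t)
  case Nil
  then show ?case by (auto elim!: ck3.cases)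
next
  case (Cons R T)
  obtain R1 v where v: "row_insert_word R s = (R1, v)" by fastforce
  obtain R2 w where w: "row_insert_word R t = (R2, w)" by fastforce
  have g: "good (R @ s)" using Cons.prems good_append2[of "reading T"] by simp
  have *: "R1 = R2 \<and> (v = w \<or> ck3 v w \<or> ck3 w v)"
    using row_insert_word_ck3[OF _ g Cons.prems(3) v w] Cons.prems by simp
  have "cke (R @ s) (v @ R1)" using row_insert_word_cke[OF _ g] v Cons.prems by simp
  then have "good ((reading T @ v) @ R1)"
    using cke_append2[of "R @ s" "v @ R1" "reading T"] Cons.prems good_cke by simp
  then have "good (reading T @ v)" by (rule good_append1)
  then have "insert_word T v = insert_word T w" using Cons * by auto
  then show ?case using * v w by (simp add: insert_word_Cons)
qed

definition P_tab :: "nat list \<Rightarrow> nat list list" where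
  "P_tab w = insert_word [] w"

definition Q_word :: "nat list \<Rightarrow> nat list" where
  "Q_word w = record_word [] w"

lemma record_word_append:
  "record_word T (v @ w) = record_word T v @ record_word (insert_word T v) w"
  by (induction v arbitrary: T) auto

lemma P_tab_Nil [simp]: "P_tab [] = []" and Q_word_Nil [simp]: "Q_word [] = []"
  by (auto simp: P_tab_def Q_word_def)

lemma P_tab_snoc: "P_tab (w @ [x]) = fst (tab_insert (P_tab w) x)"
  by (simp add: P_tab_def insert_word_append)

lemma Q_word_snoc: "Q_word (w @ [x]) = Q_word w @ [snd (tab_insert (P_tab w) x)]"
  by (simp add: P_tab_def Q_word_def record_word_append)

lemma length_Q_word [simp]: "length (Q_word w) = length w"
  by (induction w rule: rev_induct) (auto simp: Q_word_snoc)

lemma P_tab_props: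
  "good w \<Longrightarrow> tableau (P_tab w) \<and> cke w (reading (P_tab w))"
proof (induction w rule: rev_induct)
  case (snoc x w)
  have "good w" using snoc.prems by (rule good_append1)
  then have *: "tableau (P_tab w)" "cke (w @ [x]) (reading (P_tab w) @ [x])"
    using snoc.IH cke_append1 by auto
  then have "good (reading (P_tab w) @ [x])" using snoc.prems good_cke by blast
  then show ?case using tab_insert_props[OF *(1)] rtranclp_trans[OF *(2)] by (auto simp: P_tab_snoc)
qed simp

lemma P_tab_ck:
  assumes "good v" "ck v w"
  shows "P_tab v = P_tab w"
proof -
  obtain p q s t where *: "v = p @ s @ q" "w = p @ t @ q" "ck3 s t \<or> ck3 t s"
    using assms(2) unfolding ck_def by blast
  have g: "good (p @ s)" using assms(1) * good_append1[of "p @ s"] by simp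
  then have p: "tableau (P_tab p)" "cke p (reading (P_tab p))"
    using P_tab_props good_append1 by blast+
  \<comment> \<open>The prefix \<open>p\<close> is exchanged for the reading word of its tableau,
    since \<open>insert_word_ck3\<close> asks for goodness of that word.\<close>
  have "good (reading (P_tab p) @ s)" using good_cke[OF g cke_append1[OF p(2)]] .
  then have "insert_word (P_tab p) s = insert_word (P_tab p) t"
    using insert_word_ck3 p(1) *(3) by blast
  then show ?thesis by (simp add: P_tab_def * insert_word_append)
qed

lemma P_tab_cke: "cke v w \<Longrightarrow> good v \<Longrightarrow> P_tab v = P_tab w"
proof (induction rule: rtranclp_induct)
  case (step y z) then show ?case using P_tab_ck good_cke by metis
qed simp

lemma cke_iff_P_tab:
  assumes "good v"
  shows "cke v w \<longleftrightarrow> good w \<and> P_tab w = P_tab v"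
proof
  assume "cke v w" then show "good w \<and> P_tab w = P_tab v" using assms P_tab_cke good_cke by metis
next
  assume "good w \<and> P_tab w = P_tab v"
  then show "cke v w" using assms P_tab_props cke_sym by (metis rtranclp_trans)
qed

subsection \<open>Reverse insertion\<close>

text \<open>Reverse bumping. \<open>S\<close> is the row above before it received \<open>y\<close>;
  the domination hypothesis is the column condition afterwards and forces the head of
  \<open>R\<close> to exceed \<open>y\<close>. If \<open>y\<close> is not in \<open>R\<close>, the
  last entry above \<open>y\<close> gives way to \<open>y\<close> and is returned as
  \<open>x\<close>. If \<open>y\<close> is in \<open>R\<close>, the row stays as it is and the left
  neighbour \<open>Suc y\<close> of \<open>y\<close> is returned.\<close>

lemma row_uninsert:
  assumes "dec R" "good (y # R)" "dec S" "good (S @ [y])" "dom_row R (fst (row_insert S y))"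
  shows "\<exists>R0 x. R0 \<noteq> [] \<and> dec R0 \<and> row_insert R0 x = (R, Some y) \<and> dom_row R0 S \<and>
    x \<in> set R \<and> set R0 \<subseteq> insert y (set R) \<and> cke (R0 @ [x]) (y # R)"
  using assms
proof (induction R arbitrary: S)
  case Nil
  then show ?case using row_insert_nonempty[of S y] by (cases "fst (row_insert S y)") auto
next
  case (Cons a R)
  have "y < a"
    using Cons.prems(5) row_insert_hd_ge[of S y] by (cases "fst (row_insert S y)") auto
  consider "\<forall>b\<in>set R. b < y" | R' where "R = y # R'" | h R' where "R = h # R'" "y < h"
  proof (cases R)
    case Nil
    then show thesis using that(1) by simp
  next
    case (Cons h R')
    then show thesis using that Cons.prems(1) by (cases h y rule: linorder_cases) force+
  qed
  then show ?case
  proof cases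
    case 1
    \<comment> \<open>If the head \<open>b\<close> of \<open>S\<close> were at least
      \<open>y\<close>, the column condition would give the tail \<open>R\<close> a first entry of
      at least \<open>y\<close>, against the case assumption.\<close>
    have "dom_row (y # R) S"
    proof (cases S)
      case (Cons b S0)
      consider "y < b" | "y = b" | "b < y" by linarith
      then show ?thesis
      proof cases
        case 1
        then have "dom_row R (fst (row_insert S0 y))" using Cons.prems(5) Cons by simp
        then have "R \<noteq> [] \<and> y < hd R" using row_insert_hd_ge[of S0 y]
          by (cases R; cases "fst (row_insert S0 y)") auto
        then show ?thesis using \<open>\<forall>b\<in>set R. b < y\<close> by (cases R) auto
      next
        case 2
        then have "S0 \<noteq> [] \<and> b = Suc (hd S0)" using good_present[of b S0 "[]"] Cons.prems Cons by simp
        then have "R \<noteq> [] \<and> y \<le> hd R" using Cons.prems(5) Cons 2 by (cases S0; cases R) auto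
        then show ?thesis using \<open>\<forall>b\<in>set R. b < y\<close> by (cases R) auto
      next
        case 3
        then show ?thesis using Cons Cons.prems(5) by simp
      qed
    qed simp
    moreover have "cke (y # R @ [a]) (y # a # R)"
      using 1 Cons.prems \<open>y < a\<close> by (intro cke_move_left) auto
    ultimately show ?thesis using 1 Cons.prems \<open>y < a\<close>
      by (intro exI[of _ "y # R"] exI[of _ a]) auto
  next
    case 2
    then have "a = Suc y" using good_xyx[of y a R'] Cons.prems \<open>y < a\<close> by auto
    have "cke (a # y # R' @ [a]) (a # y # a # R')"
      using Cons.prems 2 by (intro cke_Cons cke_move_left) auto
    also have "cke (a # y # a # R') (y # a # y # R')"
      using ck3_imp_cke[of "[a, y, a]" "[y, a, y]" R'] ck3_braid[of y] \<open>a = Suc y\<close> by simp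
    finally show ?thesis using 2 Cons.prems dom_row_insert2
      by (intro exI[of _ "a # R"] exI[of _ a]) auto
  next
    case 3
    \<comment> \<open>The recursion drops the head of \<open>S\<close>. If \<open>y\<close> acted at
      that head, the rest of \<open>S\<close> lies below \<open>y\<close>, so inserting
      \<open>y\<close> there puts it in front, in the column of \<open>h > y\<close>.\<close>
    have d: "dom_row R (fst (row_insert (tl S) y))"
    proof (cases S)
      case Nil then show ?thesis using 3 by simp
    next
      case (Cons b S0)
      show ?thesis
      proof (cases "y < b")
        case True then show ?thesis using Cons.prems Cons by simp
      next
        case False
        then have "dom_row R S0" using Cons.prems(5) Cons by (auto split: if_splits)
        moreover have "\<forall>c\<in>set S0. c < y" using Cons.prems Cons False by auto
        ultimately show ?thesis using 3 Cons by (cases S0) auto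
      qed
    qed
    have m: "cke (a # y # R) (y # a # R)"
      using ck3_imp_cke[of "[a, y, h]" "[y, a, h]" R'] ck3_xzy[of y h a] 3 Cons.prems by simp
    then have "good (y # R)" using Cons.prems(2) good_cke cke_sym good_Cons by blast
    moreover have "dec (tl S) \<and> good (tl S @ [y])"
      using Cons.prems good_Cons by (cases S) auto
    ultimately obtain R0 x where *: "R0 \<noteq> []" "dec R0" "row_insert R0 x = (R, Some y)"
        "dom_row R0 (tl S)" "x \<in> set R" "set R0 \<subseteq> insert y (set R)" "cke (R0 @ [x]) (y # R)"
      using Cons.IH[of "tl S"] d Cons.prems(1) by auto
    have "dom_row (a # R0) S"
      using *(4) Cons.prems(5) by (cases S) (auto split: if_splits)
    moreover have "cke (a # R0 @ [x]) (y # a # R)" using m cke_Cons[OF *(7), of a] by auto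
    ultimately show ?thesis using * Cons.prems \<open>y < a\<close>
      by (intro exI[of _ "a # R0"] exI[of _ x]) auto
  qed
qed

lemma dom_row_butlast: "dom_row R S \<Longrightarrow> length S < length R \<Longrightarrow> dom_row (butlast R) S"
  by (induction R S rule: dom_row.induct) auto

lemma row_insert_last: "dec R \<Longrightarrow> R \<noteq> [] \<Longrightarrow> row_insert (butlast R) (last R) = (R, None)"
  by (induction R) auto

text \<open>The strict inequality says that row \<open>r\<close> ends in a removable corner. Its
  last letter is removed, and the letters ejected in turn descend through the rows below it.\<close>

lemma tab_uninsert:
  assumes "tableau T" "good (reading T)" "row_len T (Suc r) < row_len T r"
  shows "\<exists>T' x. tableau T' \<and> good (reading T' @ [x]) \<and> tab_insert T' x = (T, r)"
  using assms
proof (induction T arbitrary: r)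
  case (Cons R T)
  show ?case
  proof (cases r)
    case 0
    then have l: "length (first_row T) < length R" using Cons.prems by (simp add: row_len_0)
    show ?thesis
    proof (cases "tl R = []")
      case True
      then obtain x where "R = [x]" using Cons.prems by (cases R) auto
      then show ?thesis using l Cons.prems 0 by (cases T) (auto intro!: exI[of _ "[]"] exI[of _ x])
    next
      case False
      have i: "row_insert (butlast R) (last R) = (R, None)" using row_insert_last Cons.prems by simp
      have R: "R = butlast R @ [last R]" using Cons.prems by simp
      then have d: "dec (butlast R)" using Cons.prems by (metis sorted_wrt_append tableau.simps(2))
      have "butlast R \<noteq> []" using False R by (cases R) auto
      then have "tableau (butlast R # T)" using d dom_row_butlast[OF _ l] Cons.prems by simp
      moreover have "good (reading (butlast R # T) @ [last R])"
        using Cons.prems(2) R by simp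
      moreover have "tab_insert (butlast R # T) (last R) = (R # T, r)" using i 0 by simp
      ultimately show ?thesis by blast
    qed
  next
    case (Suc r')
    have "good (reading T)" using Cons.prems good_append1[of "reading T" R] by simp
    then obtain T' y where T': "tableau T'" "good (reading T' @ [y])" "tab_insert T' y = (T, r')"
      using Cons.IH[of r'] Cons.prems Suc by auto
    have c: "cke (reading T' @ [y]) (reading T)" using tab_insert_props[OF T'(1,2)] T'(3) by simp
    have g: "good (reading T' @ y # R)"
      using Cons.prems good_cke cke_sym[OF cke_append1[OF c, of R]] by simp
    have fr: "first_row T = fst (row_insert (first_row T') y)"
      using first_row_tab_insert[of T' y] T'(3) by simp
    have "dec (first_row T')" "good (first_row T' @ [y])"
      using T'(1,2) good_append2[of "reading (tl T')" "first_row T' @ [y]"] good_append2[of "[]" "[y]"]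
      by (cases T'; simp)+
    then obtain R0 x where *: "R0 \<noteq> []" "dec R0" "row_insert R0 x = (R, Some y)"
        "dom_row R0 (first_row T')" "cke (R0 @ [x]) (y # R)"
      using row_uninsert[of R y "first_row T'"] fr Cons.prems good_append2[OF g] by auto
    have "good (reading T' @ R0 @ [x])"
      using good_cke[OF g] cke_sym[OF cke_append2[OF *(5), of "reading T'"]] by simp
    then show ?thesis using * T' Suc by (intro exI[of _ "R0 # T'"] exI[of _ x]) auto
  qed
qed simp

lemma row_insert_inj:
  assumes "dec R1" "dec R2" "good (R1 @ [x1])" "good (R2 @ [x2])"
    "row_insert R1 x1 = (R, Some y)" "row_insert R2 x2 = (R, Some y)"
  shows "R1 = R2 \<and> x1 = x2"
  using assms
proof (induction R1 arbitrary: R2 R)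
  case (Cons a S1)
  obtain b S2 where R2: "R2 = b # S2" using Cons.prems(6) by (cases R2) auto
  \<comment> \<open>The result reveals where the insertion acted: if at the head, the rest of the
    new row has no entry above \<open>y\<close>; if further right, that rest contains the inserted
    letter, which exceeds \<open>y\<close>.\<close>
  have low: False
    if "dec (c # S)" "good (c # S @ [x])" "x < c" "row_insert (c # S) x = (c # S', Some y)"
      "\<forall>d\<in>set S'. d = y \<or> d < y" for c S S' x
  proof -
    have "row_insert S x = (S', Some y)" using that by (auto simp: prod_eq_iff)
    then have "y < x" "x \<in> set S'" using row_insert_Some[of S x S' y] that good_Cons[of c] by auto
    then show False using that(5) by auto
  qed
  have hd: "S \<noteq> [] \<and> c = Suc (hd S)" if "dec (c # S)" "good (c # S @ [c])" for c S
    using good_present[of c S "[]"] that by auto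
  show ?case
  proof (cases x1 a rule: linorder_cases)
    case less
    show ?thesis
    proof (cases x2 b rule: linorder_cases)
      case less': less
      obtain U where U: "row_insert S1 x1 = (U, Some y)" "row_insert S2 x2 = (U, Some y)" "a = b"
        using Cons.prems less less' R2 by (auto simp: prod_eq_iff)
      then show ?thesis using Cons.IH[OF _ _ _ _ U(1,2)] Cons.prems R2 good_Cons by auto
    next
      case equal
      then show ?thesis using Cons.prems less R2 hd[of b S2] low[of a S1 x1 S2]
        by (cases S2) auto
    next
      case greater
      then show ?thesis using Cons.prems less R2 low[of a S1 x1 S2] by auto
    qed
  next
    case equal
    show ?thesis
    proof (cases x2 b rule: linorder_cases)
      case less
      then show ?thesis using Cons.prems equal R2 hd[of a S1] low[of b S2 x2 S1]
        by (cases S1) auto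
    next
      case equal': equal
      then show ?thesis using Cons.prems equal R2 by auto
    next
      case greater
      then show ?thesis using Cons.prems equal R2 hd[of a S1] by (cases S1) auto
    qed
  next
    case greater
    show ?thesis
    proof (cases x2 b rule: linorder_cases)
      case less
      then show ?thesis using Cons.prems greater R2 low[of b S2 x2 S1] by auto
    next
      case equal
      then show ?thesis using Cons.prems greater R2 hd[of b S2] by (cases S2) auto
    next
      case greater': greater
      then show ?thesis using Cons.prems greater R2 by auto
    qed
  qed
qed simp

text \<open>The recorded index makes both insertions stop in the same row, and below it every row is
  recovered from its result and the letter it bumped.\<close>

lemma tab_insert_inj:
  assumes "tableau T1" "tableau T2" "good (reading T1 @ [x1])" "good (reading T2 @ [x2])"
    "tab_insert T1 x1 = tab_insert T2 x2"
  shows "T1 = T2 \<and> x1 = x2"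
  using assms
proof (induction T1 arbitrary: T2 x1 x2)
  case Nil
  then show ?case
    by (cases T2) (auto split: prod.splits option.splits dest!: row_insert_None)
next
  case (Cons R1 T1)
  obtain S1 o1 where 1: "row_insert R1 x1 = (S1, o1)" by fastforce
  show ?case
  proof (cases T2)
    case Nil
    then show ?thesis using Cons.prems by (auto split: prod.splits option.splits dest!: row_insert_None)
  next
    case T2: (Cons R2 U)
    obtain S2 o2 where 2: "row_insert R2 x2 = (S2, o2)" by fastforce
    show ?thesis
    proof (cases o1)
      case None
      then show ?thesis using Cons.prems T2 1 2 row_insert_None[of R1 x1 S1] row_insert_None[of R2 x2 S2]
        by (cases o2) auto
    next
      case (Some y1)
      then obtain y2 where y2: "o2 = Some y2" using Cons.prems T2 1 2 by (cases o2) auto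
      have c: "good (reading T1 @ [y1])" "good (reading U @ [y2])"
        using good_bumped[of R1 "reading T1" x1 S1 y1] good_bumped[of R2 "reading U" x2 S2 y2]
          1 2 Some y2 T2 Cons.prems by simp_all
      have e: "S1 = S2" "tab_insert T1 y1 = tab_insert U y2"
        using Cons.prems(5) 1 2 Some y2 T2 by (auto simp: prod_eq_iff)
      then have "T1 = U \<and> y1 = y2" using Cons.IH[OF _ _ c] Cons.prems T2 by simp
      then show ?thesis
        using row_insert_inj[of R1 R2 x1 x2 S1 y1] e 1 2 Some y2 T2 Cons.prems
          good_append2[of "reading T1" "R1 @ [x1]"] good_append2[of "reading U" "R2 @ [x2]"] by simp
    qed
  qed
qed

section \<open>The correspondence with lattice words\<close>

definition lattice_word :: "nat list \<Rightarrow> bool" where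
  "lattice_word q \<longleftrightarrow> (\<forall>k r. count_list (take k q) (Suc r) \<le> count_list (take k q) r)"

text \<open>A shape is a function giving all row lengths, with zeros beyond the top row, so that
  shapes can be compared pointwise.\<close>

definition lattice_words :: "(nat \<Rightarrow> nat) \<Rightarrow> nat list set" where
  "lattice_words \<mu> = {q. lattice_word q \<and> count_list q = \<mu>}"

lemma lattice_word_Nil [simp]: "lattice_word []"
  by (simp add: lattice_word_def)

lemma lattice_word_take: "lattice_word q \<Longrightarrow> lattice_word (take k q)"
  by (simp add: lattice_word_def)

lemma lattice_word_count: "lattice_word q \<Longrightarrow> count_list q (Suc r) \<le> count_list q r"
  unfolding lattice_word_def by (metis order_refl take_all)

lemma lattice_word_snoc:
  "lattice_word (q @ [x]) \<longleftrightarrow>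
     lattice_word q \<and> (\<forall>r. count_list (q @ [x]) (Suc r) \<le> count_list (q @ [x]) r)"
proof
  assume *: "lattice_word (q @ [x])"
  then show "lattice_word q \<and> (\<forall>r. count_list (q @ [x]) (Suc r) \<le> count_list (q @ [x]) r)"
    using lattice_word_take[OF *, of "length q"] lattice_word_count[OF *] by simp
next
  assume *: "lattice_word q \<and> (\<forall>r. count_list (q @ [x]) (Suc r) \<le> count_list (q @ [x]) r)"
  show "lattice_word (q @ [x])"
    unfolding lattice_word_def
  proof (intro allI)
    fix k r
    show "count_list (take k (q @ [x])) (Suc r) \<le> count_list (take k (q @ [x])) r"
      using * by (cases "k \<le> length q") (simp_all add: lattice_word_def)
  qed
qed

lemma count_Q_word: "count_list (Q_word w) = row_len (P_tab w)"
proof (induction w rule: rev_induct)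
  case (snoc x w)
  then show ?case by (auto simp: P_tab_snoc Q_word_snoc tab_insert_row_len fun_eq_iff)
qed (auto simp: fun_eq_iff)

lemma Q_word_lattice: "good w \<Longrightarrow> lattice_word (Q_word w)"
proof (induction w rule: rev_induct)
  case (snoc x w)
  have "count_list (Q_word (w @ [x])) (Suc r) \<le> count_list (Q_word (w @ [x])) r" for r
    using P_tab_props[OF snoc.prems] row_len_antimono unfolding count_Q_word by blast
  then show ?case
    using snoc good_append1 unfolding Q_word_snoc lattice_word_snoc by blast
qed simp

lemma good_Nil: "good []"
proof -
  have "v = []" if "cke [] v" for v using cke_length[OF that] by simp
  then show ?thesis by (auto simp: good_def bad_factor_def)
qed

text \<open>The last letter of \<open>q\<close> names the row of the box to remove; the ballot
  condition on the letters before it makes this box a corner of \<open>T\<close>.\<close>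

lemma Q_word_surj:
  assumes "lattice_word q" "tableau T" "good (reading T)" "count_list q = row_len T"
  shows "\<exists>w. good w \<and> P_tab w = T \<and> Q_word w = q"
  using assms
proof (induction q arbitrary: T rule: rev_induct)
  case Nil
  then have "row_len T 0 = 0" by (metis count_list.simps(1))
  then have "T = []" using Nil by (cases T) auto
  then show ?case by (intro exI[of _ "[]"]) (simp add: good_Nil)
next
  case (snoc r q)
  have q: "lattice_word q" using snoc.prems lattice_word_snoc by blast
  have l: "row_len T s = count_list q s + (if s = r then 1 else 0)" for s
    by (simp flip: snoc.prems(4))
  have "row_len T (Suc r) < row_len T r"
    using lattice_word_count[OF q, of r] by (simp add: l)
  then obtain T' x where T': "tableau T'" "good (reading T' @ [x])" "tab_insert T' x = (T, r)"
    using tab_uninsert snoc.prems by blast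
  have "count_list q = row_len T'"
    using tab_insert_row_len[of T' x] l unfolding T'(3) by (auto simp: fun_eq_iff split: if_splits)
  then obtain w where w: "good w" "P_tab w = T'" "Q_word w = q"
    using snoc.IH[OF q T'(1)] T'(2) good_append1 by blast
  have "cke (reading T' @ [x]) (w @ [x])"
    using P_tab_props[OF w(1)] w(2) cke_sym cke_append1 by blast
  then have "good (w @ [x])" using T'(2) good_cke by blast
  then show ?case using w T' by (intro exI[of _ "w @ [x]"]) (simp add: P_tab_snoc Q_word_snoc)
qed

lemma PQ_inj:
  assumes "good v" "good w" "P_tab v = P_tab w" "Q_word v = Q_word w"
  shows "v = w"
  using assms
proof (induction v arbitrary: w rule: rev_induct)
  case Nil
  then show ?case by (metis length_0_conv length_Q_word Q_word_Nil)
next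
  case (snoc x v)
  have "length w = Suc (length v)" using snoc.prems(4) by (metis length_Q_word length_append_singleton)
  then obtain w' y where w: "w = w' @ [y]" by (cases w rule: rev_cases) auto
  have g: "good v" "good w'" using snoc.prems w good_append1 by blast+
  have "good (reading (P_tab v) @ [x])" "good (reading (P_tab w') @ [y])"
    using P_tab_props[OF g(1)] P_tab_props[OF g(2)] snoc.prems(1,2) w cke_append1 good_cke by blast+
  then have *: "P_tab v = P_tab w' \<and> x = y"
    using snoc.prems w P_tab_props[OF g(1)] P_tab_props[OF g(2)]
    by (intro tab_insert_inj) (auto simp: P_tab_snoc Q_word_snoc prod_eq_iff)
  moreover have "Q_word v = Q_word w'" using snoc.prems(4) w by (simp add: Q_word_snoc)
  ultimately show ?case using snoc.IH[OF g] w by simp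
qed

lemma Q_word_bij:
  assumes "good w"
  shows "bij_betw Q_word {v. cke w v} (lattice_words (row_len (P_tab w)))"
  unfolding bij_betw_def
proof
  show "inj_on Q_word {v. cke w v}"
    using PQ_inj cke_iff_P_tab[OF assms] by (auto intro!: inj_onI)
  have "good (reading (P_tab w))" using P_tab_props[OF assms] good_cke assms by blast
  then show "Q_word ` {v. cke w v} = lattice_words (row_len (P_tab w))"
    using Q_word_surj[of _ "P_tab w"] P_tab_props[OF assms]
    by (auto simp: cke_iff_P_tab[OF assms] lattice_words_def Q_word_lattice count_Q_word)
qed

lemma Q_word_ascent:
  assumes "good w" "Suc i < length w"
  shows "Q_word w ! i < Q_word w ! Suc i \<longleftrightarrow> w ! i < w ! Suc i"
proof -
  define p where "p = take i w"
  define q where "q = drop (Suc (Suc i)) w"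
  have w: "w = p @ w ! i # w ! Suc i # q"
    using assms(2) by (simp add: p_def q_def Cons_nth_drop_Suc)
  have l: "length p = i" using assms(2) by (simp add: p_def)
  have g: "good (p @ [w ! i, w ! Suc i])" using assms(1) good_append1[of _ q] w by simp
  then have gp: "good p" by (rule good_append1)
  have "good (reading (P_tab p) @ [w ! i, w ! Suc i])"
    using g P_tab_props[OF gp] good_cke cke_append1 by blast
  moreover have "Q_word w = Q_word p @ record_word (P_tab p) (w ! i # w ! Suc i # q)"
    using w by (metis P_tab_def Q_word_def record_word_append)
  ultimately show ?thesis
    using tab_insert_two[of "P_tab p" "w ! i" "w ! Suc i"] P_tab_props[OF gp] l
    by (simp add: nth_append)
qed

section \<open>Run lengths\<close>

abbreviation run_lens :: "('a \<Rightarrow> 'a \<Rightarrow> bool) \<Rightarrow> 'a list \<Rightarrow> nat list" where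
  "run_lens P xs \<equiv> map length (runs P xs)"

lemma runs_nonempty [simp]: "runs P xs = [] \<longleftrightarrow> xs = []"
  by (induction P xs rule: runs.induct) auto

lemma run_lens_Cons2:
  "run_lens P (x # y # zs) =
    (if P x y then Suc (hd (run_lens P (y # zs))) # tl (run_lens P (y # zs))
     else 1 # run_lens P (y # zs))"
  by (simp add: hd_map map_tl)

lemma run_lens_pos: "a \<in> set (run_lens P xs) \<Longrightarrow> 0 < a"
proof (induction P xs arbitrary: a rule: runs.induct)
  case (3 P x y zs)
  then show ?case unfolding run_lens_Cons2
    by (auto split: if_splits dest: list.set_sel(2)[rotated])
qed auto

lemma sum_list_run_lens: "sum_list (run_lens P xs) = length xs"
proof (induction P xs rule: runs.induct)
  case (3 P x y zs)
  then show ?case unfolding run_lens_Cons2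
    by (cases "run_lens P (y # zs)") auto
qed auto

text \<open>Run lengths depend only on the pattern of neighbour comparisons, which is how descents
  are carried from words to recording words and on to tableaux.\<close>

lemma run_lens_cong:
  assumes "length xs = length ys"
    "\<And>i. Suc i < length xs \<Longrightarrow> P (xs ! i) (xs ! Suc i) \<longleftrightarrow> Q (ys ! i) (ys ! Suc i)"
  shows "run_lens P xs = run_lens Q ys"
  using assms
proof (induction P xs arbitrary: ys rule: runs.induct)
  case (1 P) then show ?case by simp
next
  case (2 P x) then show ?case by (cases ys) auto
next
  case (3 P x y zs)
  obtain a b cs where ys: "ys = a # b # cs" using 3 by (metis Suc_length_conv)
  have "P ((y # zs) ! i) ((y # zs) ! Suc i) \<longleftrightarrow> Q ((b # cs) ! i) ((b # cs) ! Suc i)"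
    if "Suc i < length (y # zs)" for i
    using "3.prems"(2)[of "Suc i"] that ys by simp
  then have "run_lens P (y # zs) = run_lens Q (b # cs)"
    using "3.IH" "3.prems"(1) ys by (cases "P x y") (auto simp del: runs.simps)
  moreover have "P x y \<longleftrightarrow> Q a b" using "3.prems"(2)[of 0] ys by simp
  ultimately show ?case unfolding ys run_lens_Cons2 by simp
qed

lemma run_lens_snoc:
  "run_lens P (xs @ [x, y]) =
    (if P x y then butlast (run_lens P (xs @ [x])) @ [Suc (last (run_lens P (xs @ [x])))]
     else run_lens P (xs @ [x]) @ [1])"
proof (induction xs)
  case Nil then show ?case by simp
next
  case (Cons a xs)
  obtain b ys where b: "xs @ [x] = b # ys" by (cases xs) auto
  then have b2: "xs @ [x, y] = b # ys @ [y]" by (metis append.assoc append_Cons append_Nil)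
  obtain l ls where l: "run_lens P (b # ys) = l # ls" by (cases "run_lens P (b # ys)") auto
  show ?case using Cons
    unfolding append_Cons b b2 run_lens_Cons2 l by (cases ls rule: rev_cases) (auto split: if_splits)
qed

text \<open>Needed twice: to pass between an expression and its reversal, and to remove trailing
  units of a composition as if they were leading ones.\<close>

lemma run_lens_rev: "run_lens (\<lambda>x y. P y x) (rev xs) = rev (run_lens P xs)"
proof (induction P xs rule: runs.induct)
  case (3 P x y zs)
  have IH: "run_lens (\<lambda>x y. P y x) (rev zs @ [y]) = rev (run_lens P (y # zs))"
    using 3 by (cases "P x y") auto
  obtain l ls where l: "run_lens P (y # zs) = l # ls" by (cases "run_lens P (y # zs)") auto
  have "run_lens (\<lambda>x y. P y x) (rev zs @ [y, x]) = rev (run_lens P (x # y # zs))"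
    unfolding run_lens_snoc IH run_lens_Cons2 l by simp
  then show ?case by simp
qed auto

lemma word_Des_rev: "word_Des (rev w) = run_lens (\<lambda>x y. y < x) w"
  unfolding word_Des_def using run_lens_rev[of "\<lambda>x y. y < x" w] by simp

lemma drop_units_run_lens:
  "k \<le> length xs \<Longrightarrow> drop_units k (run_lens P xs) = run_lens P (drop k xs)"
proof (induction P xs arbitrary: k rule: runs.induct)
  case (2 P x) then show ?case by (cases k) auto
next
  case (3 P x y zs)
  obtain l ls where l: "run_lens P (y # zs) = l # ls" by (cases "run_lens P (y # zs)") auto
  have "0 < l" using run_lens_pos[of l P "y # zs"] unfolding l by simp
  have c: "run_lens P (x # y # zs) = (if P x y then Suc l # ls else 1 # l # ls)"
    by (simp only: run_lens_Cons2 l list.sel)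
  show ?case
  proof (cases k)
    case 0
    then show ?thesis unfolding c by (simp del: runs.simps list.map add: c)
  next
    case (Suc j)
    have "drop_units j (l # ls) = run_lens P (drop j (y # zs))"
      using "3.IH" "3.prems" Suc l by (cases "P x y") simp_all
    moreover have "drop_units k (run_lens P (x # y # zs)) = drop_units j (l # ls)"
      unfolding c Suc using \<open>0 < l\<close> by simp
    ultimately show ?thesis by (simp add: Suc)
  qed
qed auto

text \<open>Units of the composition correspond to letters, and passing to a factor neither creates
  nor removes breaks between letters that remain neighbours.\<close>

lemma restrict_composition_run_lens:
  assumes "h \<le> i" "i \<le> length xs" "1 \<le> h"
  shows "restrict_composition h i (run_lens P xs) = run_lens P (drop (h - 1) (take i xs))"
proof -
  have "rev (drop_units (length xs - i) (rev (run_lens P (drop (h - 1) xs)))) =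
      rev (run_lens (\<lambda>x y. P y x) (drop (length xs - i) (rev (drop (h - 1) xs))))"
    using assms by (subst drop_units_run_lens[symmetric]) (auto simp: run_lens_rev)
  also have "\<dots> = run_lens P (rev (drop (length xs - i) (rev (drop (h - 1) xs))))"
    by (rule run_lens_rev[symmetric])
  finally have *: "rev (drop_units (length xs - i) (rev (run_lens P (drop (h - 1) xs)))) =
      run_lens P (rev (drop (length xs - i) (rev (drop (h - 1) xs))))" .
  have "rev (drop m (rev ys)) = take (length ys - m) ys" for m and ys :: "'a list"
    by (simp add: rev_drop)
  then have "rev (drop (length xs - i) (rev (drop (h - 1) xs))) = drop (h - 1) (take i xs)"
    using assms by (simp add: drop_take)
  with * show ?thesis
    using assms by (simp add: restrict_composition_def sum_list_run_lens drop_units_run_lens)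
qed

section \<open>Lattice words and standard Young tableaux\<close>

definition part_fun :: "nat list \<Rightarrow> nat \<Rightarrow> nat" where
  "part_fun lam r = (if r < length lam then lam ! r else 0)"

lemma diagram_iff: "(r, c) \<in> diagram lam \<longleftrightarrow> c < part_fun lam r"
  by (auto simp: diagram_def part_fun_def)

lemma part_fun_antimono: "is_partition lam \<Longrightarrow> part_fun lam (Suc r) \<le> part_fun lam r"
  unfolding is_partition_def part_fun_def using sorted_wrt_nth_less[of "(\<ge>)" lam r "Suc r"] by auto

lemma card_diagram: "finite (diagram lam) \<and> card (diagram lam) = sum_list lam"
proof -
  have *: "diagram lam = Sigma {..<length lam} (\<lambda>r. {..<lam ! r})"
    by (auto simp: diagram_def)
  show ?thesis
    unfolding * by (simp add: sum_list_sum_nth atLeast0LessThan)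
qed

text \<open>The box added by letter \<open>i\<close>: it goes to the end of row
  \<open>q ! i\<close>, so its column, counted from 0, is the number of earlier letters with that
  value.\<close>

definition cell :: "nat list \<Rightarrow> nat \<Rightarrow> nat \<times> nat" where
  "cell q i = (q ! i, count_list (take i q) (q ! i))"

lemma count_take_mono: "i \<le> j \<Longrightarrow> count_list (take i q) r \<le> count_list (take j q) r"
  by (metis count_list_append le_add1 le_add_diff_inverse take_add)

lemma count_take_less:
  assumes "i < j" "j \<le> length q"
  shows "count_list (take i q) (q ! i) < count_list (take j q) (q ! i)"
proof -
  have "count_list (take (Suc i) q) (q ! i) \<le> count_list (take j q) (q ! i)"
    using assms by (intro count_take_mono) simp
  then show ?thesis using assms by (simp add: take_Suc_conv_app_nth)
qed

lemma count_list_occurrence: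
  "c < count_list q r \<Longrightarrow> \<exists>i<length q. q ! i = r \<and> count_list (take i q) r = c"
proof (induction q rule: rev_induct)
  case (snoc x q)
  show ?case
  proof (cases "c < count_list q r")
    case True
    then obtain i where "i < length q" "q ! i = r" "count_list (take i q) r = c" using snoc by blast
    then show ?thesis by (intro exI[of _ i]) (auto simp: nth_append)
  next
    case False
    then show ?thesis using snoc.prems by (intro exI[of _ "length q"]) (auto split: if_splits)
  qed
qed simp

lemma cell_surj: "c < count_list q r \<Longrightarrow> \<exists>i<length q. cell q i = (r, c)"
  using count_list_occurrence[of c q r] by (auto simp: cell_def)

lemma cell_bij: "bij_betw (cell q) {..<length q} {(r, c). c < count_list q r}"
  unfolding bij_betw_def
proof
  have *: False if "i < j" "j < length q" "cell q i = cell q j" for i j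
    using that count_take_less[of i j q] unfolding cell_def by (metis less_imp_le less_irrefl prod.inject)
  show "inj_on (cell q) {..<length q}"
    using * by (intro inj_onI) (metis lessThan_iff linorder_cases)
  show "cell q ` {..<length q} = {(r, c). c < count_list q r}"
  proof (intro equalityI subsetI)
    fix x assume "x \<in> cell q ` {..<length q}"
    then show "x \<in> {(r, c). c < count_list q r}"
      using count_take_less[of _ "length q" q] by (auto simp: cell_def)
  next
    fix x assume "x \<in> {(r, c). c < count_list q r}"
    then obtain r c where "x = (r, c)" "c < count_list q r" by auto
    then obtain i where "i < length q" "cell q i = x"
      using cell_surj[of c q r] by auto
    then show "x \<in> cell q ` {..<length q}" by auto
  qed
qed

definition word_tab :: "nat list \<Rightarrow> nat list \<Rightarrow> nat \<times> nat \<Rightarrow> nat" where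
  "word_tab lam q = (\<lambda>x\<in>diagram lam. Suc (the_inv_into {..<length q} (cell q) x))"

lemma lattice_words_diagram:
  assumes "q \<in> lattice_words (part_fun lam)"
  shows "diagram lam = {(r, c). c < count_list q r}" "length q = sum_list lam"
proof -
  show *: "diagram lam = {(r, c). c < count_list q r}"
    using assms diagram_iff by (auto simp: lattice_words_def)
  show "length q = sum_list lam"
    using bij_betw_same_card[OF cell_bij[of q]] card_diagram[of lam] unfolding * by simp
qed

lemma word_tab_cell:
  assumes "q \<in> lattice_words (part_fun lam)" "i < length q"
  shows "cell q i \<in> diagram lam" "word_tab lam q (cell q i) = Suc i"
proof -
  show *: "cell q i \<in> diagram lam"
    using assms lattice_words_diagram(1)[OF assms(1)] bij_betwE[OF cell_bij[of q]] by auto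
  then show "word_tab lam q (cell q i) = Suc i"
    using assms(2) cell_bij[of q] by (simp add: word_tab_def the_inv_into_f_f bij_betw_def)
qed

lemma word_tab_iff:
  assumes "q \<in> lattice_words (part_fun lam)" "x \<in> diagram lam"
  shows "word_tab lam q x = Suc i \<longleftrightarrow> i < length q \<and> x = cell q i"
proof -
  obtain j where "j < length q" "x = cell q j"
    using assms lattice_words_diagram(1)[OF assms(1)] bij_betw_imp_surj_on[OF cell_bij[of q]] by auto
  then show ?thesis
    using word_tab_cell[OF assms(1)] by (metis Suc_inject)
qed

lemma word_tab_SYT:
  assumes "q \<in> lattice_words (part_fun lam)"
  shows "word_tab lam q \<in> SYT lam"
proof -
  note D = lattice_words_diagram[OF assms]
  have "bij_betw (the_inv_into {..<length q} (cell q)) (diagram lam) {..<length q}"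
    unfolding D(1) by (intro bij_betw_the_inv_into cell_bij)
  moreover have "bij_betw Suc {..<length q} {1..length q}"
    by (simp add: image_Suc_lessThan bij_betw_def)
  ultimately have "bij_betw (Suc \<circ> the_inv_into {..<length q} (cell q)) (diagram lam) {1..length q}"
    by (rule bij_betw_trans)
  then have b: "bij_betw (word_tab lam q) (diagram lam) {1..sum_list lam}"
    unfolding D(2)[symmetric] by (rule bij_betw_cong[THEN iffD1, rotated]) (simp add: word_tab_def)
  have row: "word_tab lam q (r, c) < word_tab lam q (r, Suc c)" if "(r, Suc c) \<in> diagram lam" for r c
  proof -
    have h: "Suc c < count_list q r" using that unfolding D(1) by simp
    obtain j where j: "j < length q" "cell q j = (r, Suc c)"
      using cell_surj[of "Suc c" q r] h by auto
    obtain i where i: "i < length q" "cell q i = (r, c)"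
      using cell_surj[of c q r] h by auto
    have "i < j"
    proof (rule ccontr)
      assume "\<not> i < j"
      then show False using count_take_mono[of j i q r] i j by (auto simp: cell_def)
    qed
    then show ?thesis
      using word_tab_cell(2)[OF assms i(1)] word_tab_cell(2)[OF assms j(1)] i(2) j(2) by simp
  qed
  have col: "word_tab lam q (r, c) < word_tab lam q (Suc r, c)" if "(Suc r, c) \<in> diagram lam" for r c
  proof -
    have h: "c < count_list q (Suc r)" using that unfolding D(1) by simp
    have l: "count_list (take k q) (Suc r) \<le> count_list (take k q) r" for k
      using assms by (auto simp: lattice_words_def lattice_word_def)
    obtain j where j: "j < length q" "cell q j = (Suc r, c)"
      using cell_surj[of c q "Suc r"] h by auto
    have "c < count_list q r" using h l[of "length q"] by simp
    then obtain i where i: "i < length q" "cell q i = (r, c)"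
      using cell_surj[of c q r] by auto
    have "i < j"
    proof (rule ccontr)
      assume "\<not> i < j"
      then have "count_list (take j q) r \<le> c" using count_take_mono[of j i q r] i by (auto simp: cell_def)
      \<comment> \<open>After letter \<open>j\<close> row \<open>Suc r\<close> has
        \<open>Suc c\<close> boxes, whereas row \<open>r\<close> still has at most
        \<open>c\<close>.\<close>
      then show False using l[of "Suc j"] j by (auto simp: cell_def take_Suc_conv_app_nth)
    qed
    then show ?thesis
      using word_tab_cell(2)[OF assms i(1)] word_tab_cell(2)[OF assms j(1)] i(2) j(2) by simp
  qed
  have "word_tab lam q \<in> diagram lam \<rightarrow>\<^sub>E {1..sum_list lam}"
    using bij_betwE[OF b] by (auto simp: word_tab_def)
  then show ?thesis using b row col by (simp add: SYT_def)
qed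

lemma SYT_mono:
  assumes "is_partition lam" "T \<in> SYT lam" "(r', c') \<in> diagram lam" "r \<le> r'" "c \<le> c'"
  shows "(r, c) \<in> diagram lam \<and> T (r, c) \<le> T (r', c')"
proof -
  have 1: "(r, c') \<in> diagram lam \<and> T (r, c') \<le> T (r', c')"
    using assms(4,3)
  proof (induction r' rule: dec_induct)
    case (step n)
    have "(n, c') \<in> diagram lam"
      using step.prems part_fun_antimono[OF assms(1), of n] by (auto simp: diagram_iff)
    moreover have "T (n, c') < T (Suc n, c')" using assms(2) step.prems by (auto simp: SYT_def)
    ultimately show ?case using step.IH by auto
  qed simp
  have "(r, c') \<in> diagram lam \<Longrightarrow> (r, c) \<in> diagram lam \<and> T (r, c) \<le> T (r, c')"
    using assms(5)
  proof (induction c' rule: dec_induct)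
    case (step n)
    have "(r, n) \<in> diagram lam" using step.prems by (auto simp: diagram_iff)
    moreover have "T (r, n) < T (r, Suc n)" using assms(2) step.prems by (auto simp: SYT_def)
    ultimately show ?case using step.IH by auto
  qed simp
  then show ?thesis using 1 by auto
qed

lemma SYT_bij: "T \<in> SYT lam \<Longrightarrow> bij_betw T (diagram lam) {1..sum_list lam}"
  by (simp add: SYT_def)

text \<open>If \<open>y\<close> were strictly above and strictly right of \<open>x\<close>, the cell
  in the row of \<open>x\<close> and the column of \<open>y\<close> would carry an entry strictly
  between two consecutive numbers.\<close>

lemma SYT_descent_iff:
  assumes "is_partition lam" "T \<in> SYT lam" "x \<in> diagram lam" "y \<in> diagram lam" "T y = Suc (T x)"
  shows "snd y \<le> snd x \<longleftrightarrow> fst x < fst y"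
proof -
  obtain r c r' c' where x: "x = (r, c)" and y: "y = (r', c')" by (metis surj_pair)
  show ?thesis
  proof
    assume "snd y \<le> snd x"
    then show "fst x < fst y" using SYT_mono[OF assms(1,2), of r c r' c'] assms x y by force
  next
    assume l: "fst x < fst y"
    show "snd y \<le> snd x"
    proof (rule ccontr)
      assume l2: "\<not> snd y \<le> snd x"
      have z: "(r, c') \<in> diagram lam" "T (r, c') \<le> T y"
        using SYT_mono[OF assms(1,2), of r' c' r c'] assms x y l by auto
      then have "T x \<le> T (r, c')" using SYT_mono[OF assms(1,2), of r c' r c] l2 x y by auto
      then have "T (r, c') = T x \<or> T (r, c') = T y" using z assms(5) by linarith
      then have "(r, c') = x \<or> (r, c') = y"
        using SYT_bij[OF assms(2)] z(1) assms(3,4) by (auto simp: bij_betw_def dest: inj_onD)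
      then show False using l l2 x y by auto
    qed
  qed
qed

lemma SYT_word:
  assumes lam: "is_partition lam" and T: "T \<in> SYT lam"
  shows "\<exists>q \<in> lattice_words (part_fun lam). word_tab lam q = T"
proof -
  define N where "N = sum_list lam"
  define g where "g = the_inv_into (diagram lam) T"
  have b: "bij_betw T (diagram lam) {1..N}" using SYT_bij[OF T] by (simp add: N_def)
  have g: "g (Suc i) \<in> diagram lam" "T (g (Suc i)) = Suc i" if "i < N" for i
    using that b unfolding g_def
    by (auto simp: bij_betw_def the_inv_into_f_f intro: f_the_inv_into_f the_inv_into_into)
  have gT: "g (T x) = x" if "x \<in> diagram lam" for x
    using that b unfolding g_def by (auto simp: bij_betw_def the_inv_into_f_f)
  have TN: "1 \<le> T x \<and> T x \<le> N" if "x \<in> diagram lam" for x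
    using that bij_betwE[OF b] by auto
  define q where "q = map (\<lambda>i. fst (g (Suc i))) [0..<N]"
  have len: "length q = N" by (simp add: q_def)
  \<comment> \<open>The first \<open>k\<close> letters of \<open>q\<close> describe the shape formed
    by the entries up to \<open>k\<close>; the ballot condition for \<open>q\<close> thereby becomes
    the column condition for \<open>T\<close>.\<close>
  have cnt: "count_list (take k q) r = card {c. (r, c) \<in> diagram lam \<and> T (r, c) \<le> k}"
    if "k \<le> N" for k r
  proof -
    have "count_list (take k q) r = card {i. i < k \<and> q ! i = r}"
      using that len by (simp add: count_list_eq_length_filter length_filter_conv_card conj_commute)
        (metis (lifting) min.absorb2 min_less_iff_conj nth_take)
    also have "\<dots> = card {c. (r, c) \<in> diagram lam \<and> T (r, c) \<le> k}"
    proof (rule bij_betw_same_card[of "\<lambda>i. snd (g (Suc i))"], rule bij_betw_byWitness[of _ "\<lambda>c. T (r, c) - 1"])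
      show "\<forall>i\<in>{i. i < k \<and> q ! i = r}. T (r, snd (g (Suc i))) - 1 = i"
        using g that by (auto simp: q_def)
      show "\<forall>c\<in>{c. (r, c) \<in> diagram lam \<and> T (r, c) \<le> k}. snd (g (Suc (T (r, c) - 1))) = c"
      proof
        fix c assume "c \<in> {c. (r, c) \<in> diagram lam \<and> T (r, c) \<le> k}"
        moreover from this have "Suc (T (r, c) - 1) = T (r, c)" using TN[of "(r, c)"] by simp
        ultimately show "snd (g (Suc (T (r, c) - 1))) = c" using gT[of "(r, c)"] by simp
      qed
      show "(\<lambda>i. snd (g (Suc i))) ` {i. i < k \<and> q ! i = r} \<subseteq> {c. (r, c) \<in> diagram lam \<and> T (r, c) \<le> k}"
        using g that by (auto simp: q_def)
      show "(\<lambda>c. T (r, c) - 1) ` {c. (r, c) \<in> diagram lam \<and> T (r, c) \<le> k} \<subseteq> {i. i < k \<and> q ! i = r}"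
      proof safe
        fix c assume *: "(r, c) \<in> diagram lam" "T (r, c) \<le> k"
        show "T (r, c) - 1 < k" using TN[OF *(1)] * by linarith
        then show "q ! (T (r, c) - 1) = r" using TN[OF *(1)] gT[OF *(1)] that by (simp add: q_def)
      qed
    qed
    finally show ?thesis .
  qed
  have fin: "finite {c. (r, c) \<in> diagram lam \<and> P c}" for r P
    by (rule finite_subset[of _ "{..<part_fun lam r}"]) (auto simp: diagram_iff)
  have "count_list (take k q) (Suc r) \<le> count_list (take k q) r" for k r
  proof -
    have "count_list (take (min k N) q) (Suc r) \<le> count_list (take (min k N) q) r"
      unfolding cnt[OF min.cobounded2]
    proof (rule card_mono[OF fin], safe)
      fix c assume *: "(Suc r, c) \<in> diagram lam" "T (Suc r, c) \<le> min k N"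
      then show "(r, c) \<in> diagram lam" using SYT_mono[OF lam T, of "Suc r" c r c] by simp
      show "T (r, c) \<le> min k N" using SYT_mono[OF lam T, of "Suc r" c r c] * by simp
    qed
    then show ?thesis using len by (cases "k \<le> N") (simp_all add: min_def)
  qed
  moreover have "count_list q r = part_fun lam r" for r
  proof -
    have "{c. (r, c) \<in> diagram lam \<and> T (r, c) \<le> N} = {..<part_fun lam r}"
      using TN by (auto simp: diagram_iff)
    then show ?thesis using cnt[of N r] len by simp
  qed
  ultimately have q: "q \<in> lattice_words (part_fun lam)"
    by (auto simp: lattice_words_def lattice_word_def)
  have "cell q i = g (Suc i)" if i: "i < N" for i
  proof -
    obtain r c where rc: "g (Suc i) = (r, c)" by fastforce
    have qi: "q ! i = r" using i rc by (simp add: q_def)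
    \<comment> \<open>Rows increase, so the entries up to \<open>i\<close> in row \<open>r\<close>
      fill exactly the cells left of the one holding \<open>Suc i\<close>; their number is its
      column.\<close>
    have "{c'. (r, c') \<in> diagram lam \<and> T (r, c') \<le> i} = {..<c}"
    proof (intro equalityI subsetI)
      fix c' assume "c' \<in> {c'. (r, c') \<in> diagram lam \<and> T (r, c') \<le> i}"
      then show "c' \<in> {..<c}"
        using g[OF i] rc SYT_mono[OF lam T, of r c' r c] by (cases "c' < c") auto
    next
      fix c' assume "c' \<in> {..<c}"
      then have "(r, c') \<in> diagram lam \<and> T (r, c') \<le> Suc i \<and> (r, c') \<noteq> (r, c)"
        using g[OF i] rc SYT_mono[OF lam T, of r c r c'] by auto
      moreover from this have "T (r, c') \<noteq> Suc i" using gT rc by metis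
      ultimately show "c' \<in> {c'. (r, c') \<in> diagram lam \<and> T (r, c') \<le> i}" by auto
    qed
    then show ?thesis using cnt[of i r] i rc qi by (simp add: cell_def)
  qed
  then have "T (cell q i) = word_tab lam q (cell q i)" if "i < N" for i
    using that g word_tab_cell(2)[OF q] len by simp
  moreover have "\<exists>i<N. x = cell q i" if "x \<in> diagram lam" for x
    using that lattice_words_diagram(1)[OF q] bij_betw_imp_surj_on[OF cell_bij[of q]] len by auto
  ultimately have "word_tab lam q x = T x" if "x \<in> diagram lam" for x using that by metis
  moreover have "word_tab lam q x = T x" if "x \<notin> diagram lam" for x
    using that T by (cases x) (auto simp: word_tab_def SYT_def PiE_def extensional_def)
  ultimately have "word_tab lam q = T" by (intro ext) blast
  then show ?thesis using q by blast
qed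

lemma word_tab_bij:
  assumes "is_partition lam"
  shows "bij_betw (word_tab lam) (lattice_words (part_fun lam)) (SYT lam)"
  unfolding bij_betw_def
proof
  show "inj_on (word_tab lam) (lattice_words (part_fun lam))"
  proof (rule inj_onI)
    fix q q' assume *: "q \<in> lattice_words (part_fun lam)" "q' \<in> lattice_words (part_fun lam)"
      "word_tab lam q = word_tab lam q'"
    show "q = q'"
    proof (rule nth_equalityI)
      show "length q = length q'" using lattice_words_diagram(2) * by metis
      fix i assume "i < length q"
      then have "cell q i = cell q' i"
        using word_tab_cell[OF *(1)] word_tab_iff[OF *(2)] *(3) by metis
      then show "q ! i = q' ! i" by (simp add: cell_def)
    qed
  qed
  show "word_tab lam ` lattice_words (part_fun lam) = SYT lam"
    using word_tab_SYT SYT_word[OF assms] by (auto simp: image_iff) metis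
qed

text \<open>For consecutive entries, weakly left means strictly higher
  (\<open>SYT_descent_iff\<close>), so descents of the tableau are ascents of the lattice
  word.\<close>

lemma tableau_Des_word_tab:
  assumes lam: "is_partition lam" and q: "q \<in> lattice_words (part_fun lam)"
  shows "tableau_Des lam (word_tab lam q) = run_lens (\<lambda>x y. y \<le> x) q"
  unfolding tableau_Des_def
proof (rule run_lens_cong)
  show "length [1..<Suc (sum_list lam)] = length q"
    using lattice_words_diagram(2)[OF q] by (simp del: upt_Suc)
  fix i assume "Suc i < length [1..<Suc (sum_list lam)]"
  then have i: "Suc i < length q"
    using lattice_words_diagram(2)[OF q] by (simp del: upt_Suc)
  let ?x = "cell q i" and ?y = "cell q (Suc i)"
  have "tableau_descent lam (word_tab lam q) (Suc i) \<longleftrightarrow> snd ?y \<le> snd ?x"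
    unfolding tableau_descent_def using word_tab_iff[OF q] word_tab_cell[OF q] i
    by (metis Suc_lessD)
  also have "\<dots> \<longleftrightarrow> fst ?x < fst ?y"
    using word_tab_cell[OF q] i by (intro SYT_descent_iff[OF lam word_tab_SYT[OF q]]) auto
  finally show "(\<not> tableau_descent lam (word_tab lam q) ([1..<Suc (sum_list lam)] ! i)) =
      (q ! Suc i \<le> q ! i)"
    using i lattice_words_diagram(2)[OF q] by (simp add: cell_def not_less del: upt_Suc)
qed

lemma schur_lattice_words:
  assumes "is_partition lam"
  shows "schur lam m = (\<Sum>q\<in>lattice_words (part_fun lam). fundamental (run_lens (\<lambda>x y. y \<le> x) q) m)"
  unfolding schur_def
  using sum.reindex_bij_betw[OF word_tab_bij[OF assms], of "\<lambda>T. fundamental (tableau_Des lam T) m"]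
    tableau_Des_word_tab[OF assms] by simp

section \<open>The fundamental functions of one equivalence class\<close>

lemma part_fun_shape: "part_fun (map length T) = row_len T"
  by (auto simp: part_fun_def row_len_def)

lemma is_partition_shape:
  assumes "tableau T"
  shows "is_partition (map length T)"
proof -
  have "map length T ! Suc i \<le> map length T ! i" if "Suc i < length T" for i
    using row_len_antimono[OF assms, of i] that by (simp add: row_len_def)
  then have "sorted_wrt (\<ge>) (map length T)"
    by (subst sorted_wrt_iff_nth_Suc_transp) (auto intro!: transpI)
  moreover have "R \<in> set T \<Longrightarrow> R \<noteq> []" for R using assms by (induction T) auto
  ultimately show ?thesis by (auto simp: is_partition_def)
qed

text \<open>Neighbours in a good word are distinct, so a non-ascent there is a strict descent,
  whereas recording words may repeat a row. This explains the strict relation on one side and the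
  weak one on the other.\<close>

lemma word_Des_Q_word:
  assumes "good w"
  shows "word_Des (rev w) = run_lens (\<lambda>x y. y \<le> x) (Q_word w)"
  unfolding word_Des_rev
proof (rule run_lens_cong)
  fix i assume i: "Suc i < length w"
  have "w = take i w @ w ! i # w ! Suc i # drop (Suc (Suc i)) w"
    using i by (simp add: Cons_nth_drop_Suc)
  then have "w ! i \<noteq> w ! Suc i" using assms good_sq by metis
  then show "(w ! Suc i < w ! i) = (Q_word w ! Suc i \<le> Q_word w ! i)"
    using Q_word_ascent[OF assms i] by linarith
qed simp

lemma class_sum_schur:
  assumes "good w"
  shows "(\<Sum>v | cke w v. fundamental (word_Des (rev v)) m) = schur (map length (P_tab w)) m"
proof -
  have "is_partition (map length (P_tab w))" using P_tab_props[OF assms] is_partition_shape by blast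
  then have "schur (map length (P_tab w)) m =
      (\<Sum>v | cke w v. fundamental (run_lens (\<lambda>x y. y \<le> x) (Q_word v)) m)"
    unfolding schur_lattice_words[OF \<open>is_partition _\<close>] part_fun_shape
    by (intro sum.reindex_bij_betw[OF Q_word_bij[OF assms], symmetric])
  also have "\<dots> = (\<Sum>v | cke w v. fundamental (word_Des (rev v)) m)"
    using assms good_cke by (intro sum.cong refl) (auto simp: word_Des_Q_word)
  finally show ?thesis by simp
qed

section \<open>Coefficients of fundamental quasisymmetric functions\<close>

text \<open>The usual subset attached to a composition, with both end points kept.\<close>

definition psums :: "nat list \<Rightarrow> nat set" where
  "psums \<alpha> = (\<lambda>j. sum_list (take j \<alpha>)) ` {..length \<alpha>}"

lemma psums_Nil [simp]: "psums [] = {0}"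
  by (simp add: psums_def)

lemma psums_Cons: "psums (a # \<alpha>) = insert 0 ((+) a ` psums \<alpha>)"
proof -
  have "{..length (a # \<alpha>)} = insert 0 (Suc ` {..length \<alpha>})"
    by (simp add: atMost_Suc_eq_insert_0)
  then show ?thesis unfolding psums_def by (simp add: image_image)
qed

lemma psums_snoc: "psums (\<alpha> @ [b]) = insert (sum_list \<alpha> + b) (psums \<alpha>)"
  by (induction \<alpha>) (auto simp: psums_Cons)

lemma zero_in_psums [simp]: "0 \<in> psums \<alpha>"
  by (cases \<alpha>) (auto simp: psums_Cons)

lemma sum_list_in_psums [simp]: "sum_list \<alpha> \<in> psums \<alpha>"
  by (cases \<alpha> rule: rev_cases) (auto simp: psums_snoc)

lemma psums_le: "k \<in> psums \<alpha> \<Longrightarrow> k \<le> sum_list \<alpha>"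
  by (induction \<alpha> arbitrary: k rule: rev_induct) (force simp: psums_snoc)+

text \<open>Turns refinement into inclusion of sets. Positivity of the parts of \<alpha> is what
  makes the chosen indices strictly increasing.\<close>

lemma refines_iff_psums:
  assumes "\<forall>a\<in>set \<alpha>. 0 < a"
  shows "refines \<beta> \<alpha> \<longleftrightarrow> sum_list \<beta> = sum_list \<alpha> \<and> psums \<alpha> \<subseteq> psums \<beta>"
proof
  assume *: "refines \<beta> \<alpha>"
  then obtain i where i: "\<forall>j\<in>{1..length \<alpha>}. i j \<le> length \<beta> \<and> sum_list (take (i j) \<beta>) = sum_list (take j \<alpha>)"
    unfolding refines_def by blast
  have "sum_list (take j \<alpha>) \<in> psums \<beta>" if "j \<le> length \<alpha>" for j
  proof (cases "j = 0")
    case False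
    then have "j \<in> {1..length \<alpha>}" using that by simp
    then have "sum_list (take j \<alpha>) = sum_list (take (i j) \<beta>)" "i j \<le> length \<beta>" using i by metis+
    then show ?thesis unfolding psums_def by auto
  qed simp
  then show "sum_list \<beta> = sum_list \<alpha> \<and> psums \<alpha> \<subseteq> psums \<beta>"
    using * unfolding refines_def psums_def[of \<alpha>] by auto
next
  assume *: "sum_list \<beta> = sum_list \<alpha> \<and> psums \<alpha> \<subseteq> psums \<beta>"
  have "\<exists>k. k \<le> length \<beta> \<and> sum_list (take k \<beta>) = sum_list (take j \<alpha>)" if "j \<le> length \<alpha>" for j
  proof -
    have "sum_list (take j \<alpha>) \<in> psums \<beta>" using * that unfolding psums_def[of \<alpha>] by auto
    then show ?thesis unfolding psums_def by force
  qed
  then obtain i where i: "\<And>j. j \<le> length \<alpha> \<Longrightarrow> i j \<le> length \<beta> \<and> sum_list (take (i j) \<beta>) = sum_list (take j \<alpha>)"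
    by metis
  have mono: "sum_list (take k xs) \<le> sum_list (take l xs)" if "k \<le> l" for k l and xs :: "nat list"
    by (metis that le_add1 le_add_diff_inverse sum_list_append take_add)
  have "i j < i k" if jk: "j < k" "k \<le> length \<alpha>" for j k
  proof (rule ccontr)
    assume "\<not> i j < i k"
    then have "sum_list (take (i k) \<beta>) \<le> sum_list (take (i j) \<beta>)" by (intro mono) simp
    then have "sum_list (take k \<alpha>) \<le> sum_list (take j \<alpha>)" using i jk by simp
    moreover have "sum_list (take (Suc j) \<alpha>) \<le> sum_list (take k \<alpha>)" using jk by (intro mono) simp
    moreover have "sum_list (take (Suc j) \<alpha>) = sum_list (take j \<alpha>) + \<alpha> ! j"
      using jk by (simp add: take_Suc_conv_app_nth)
    moreover have "0 < \<alpha> ! j" using assms jk by simp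
    ultimately show False by linarith
  qed
  then have "strict_mono_on {1..length \<alpha>} i" by (auto intro!: strict_mono_onI)
  then show "refines \<beta> \<alpha>" using * i unfolding refines_def by auto
qed

lemma psums_run_lens:
  "psums (run_lens P xs) =
     insert 0 (insert (length xs) {Suc i | i. Suc i < length xs \<and> \<not> P (xs ! i) (xs ! Suc i)})"
proof (induction P xs rule: runs.induct)
  case (1 P) then show ?case by auto
next
  case (2 P x) then show ?case by (auto simp: psums_Cons)
next
  case (3 P x y zs)
  let ?B = "\<lambda>xs. {Suc i | i. Suc i < length xs \<and> \<not> P (xs ! i) (xs ! Suc i)}"
  obtain l ls where l: "run_lens P (y # zs) = l # ls" by (cases "run_lens P (y # zs)") auto
  have "0 < l" using run_lens_pos[of l P "y # zs"] unfolding l by simp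
  have IH: "psums (l # ls) = insert 0 (insert (length (y # zs)) (?B (y # zs)))"
    using "3.IH" l by (cases "P x y") simp_all
  have B: "?B (x # y # zs) = (if P x y then {} else {Suc 0}) \<union> Suc ` ?B (y # zs)" (is "?L = ?R")
  proof (intro equalityI subsetI)
    fix k assume "k \<in> ?L"
    then obtain i where i: "k = Suc i" "Suc i < length (x # y # zs)" "\<not> P ((x # y # zs) ! i) ((x # y # zs) ! Suc i)"
      by blast
    then show "k \<in> ?R" by (cases i) auto
  next
    fix k assume "k \<in> ?R"
    then consider "\<not> P x y" "k = Suc 0" | i where "k = Suc (Suc i)" "Suc i < length (y # zs)"
        "\<not> P ((y # zs) ! i) ((y # zs) ! Suc i)"
      by (auto split: if_splits)
    then show "k \<in> ?L" by cases auto
  qed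
  have c: "run_lens P (x # y # zs) = (if P x y then Suc l # ls else 1 # l # ls)"
    by (simp only: run_lens_Cons2 l list.sel)
  have 0: "0 \<notin> (+) l ` psums ls" using \<open>0 < l\<close> by auto
  have s: "psums (Suc l # ls) = insert 0 (Suc ` (psums (l # ls) - {0}))"
    using 0 unfolding psums_Cons by (simp add: image_image)
  have s1: "psums (1 # l # ls) = insert 0 (Suc ` psums (l # ls))"
    unfolding psums_Cons[of 1] by (simp add: image_def)
  show ?case
    unfolding c B using s s1 unfolding IH by auto
qed

text \<open>The list may break only at block boundaries: neighbours inside a block of \<beta> are
  related by \<open>P\<close>.\<close>

definition block_compat :: "('a \<Rightarrow> 'a \<Rightarrow> bool) \<Rightarrow> nat list \<Rightarrow> 'a list \<Rightarrow> bool" where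
  "block_compat P \<beta> xs \<longleftrightarrow> sum_list \<beta> = length xs \<and>
     (\<forall>i. Suc i < length xs \<longrightarrow> \<not> P (xs ! i) (xs ! Suc i) \<longrightarrow> Suc i \<in> psums \<beta>)"

lemma refines_run_lens: "refines \<beta> (run_lens P xs) \<longleftrightarrow> block_compat P \<beta> xs"
proof -
  have "\<forall>a\<in>set (run_lens P xs). 0 < a" using run_lens_pos by blast
  then show ?thesis
    unfolding refines_iff_psums[OF \<open>\<forall>a\<in>_. _\<close>] block_compat_def sum_list_run_lens psums_run_lens
    using sum_list_in_psums[of \<beta>] by (auto simp del: sum_list_in_psums)
qed

text \<open>The nonzero exponents in the order of the variables; this is the common flattening of
  all weak compositions with the given monomial.\<close>

definition exps :: "(nat \<Rightarrow>\<^sub>0 nat) \<Rightarrow> nat list" where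
  "exps m = map (Poly_Mapping.lookup m) (sorted_list_of_set (Poly_Mapping.keys m))"

lemma flat_eq_exps: "flat b = exps (Poly_Mapping.nth b)"
proof -
  let ?I = "filter (\<lambda>i. 0 < b ! i) [0..<length b]"
  have "Poly_Mapping.keys (Poly_Mapping.nth b) = set ?I"
    by (auto simp: Poly_Mapping.in_keys_iff nth_default_def simp del: Poly_Mapping.keys_nth split: if_splits)
  moreover have "sorted ?I" "distinct ?I" by (auto intro: sorted_wrt_filter)
  ultimately have *: "sorted_list_of_set (Poly_Mapping.keys (Poly_Mapping.nth b)) = ?I"
    by (simp only: sorted_list_of_set.idem_if_sorted_distinct)
  have "flat b = filter ((<) 0) (map ((!) b) [0..<length b])" by (simp add: flat_def map_nth)
  also have "\<dots> = map ((!) b) ?I" by (simp add: filter_map o_def)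
  also have "\<dots> = map (nth_default 0 b) ?I" by (auto simp: nth_default_def)
  finally show ?thesis by (simp only: exps_def * Poly_Mapping.lookup_nth)
qed

lemma fundamental_run_lens: "fundamental (run_lens P xs) m = of_bool (block_compat P (exps m) xs)"
proof -
  have "\<exists>b. Poly_Mapping.nth b = m" using Poly_Mapping.nth_idem by blast
  then have "(\<exists>b. Poly_Mapping.nth b = m \<and> refines (flat b) (run_lens P xs)) \<longleftrightarrow>
      block_compat P (exps m) xs"
    unfolding flat_eq_exps refines_run_lens by blast
  then show ?thesis by (simp only: fundamental_def)
qed

lemma mset_exps_map_key:
  assumes "bij \<pi>"
  shows "mset (exps (Poly_Mapping.map_key \<pi> m)) = mset (exps m)"
proof -
  have inj: "inj \<pi>" using assms by (rule bij_is_inj)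
  have e: "mset (exps m) = image_mset (Poly_Mapping.lookup m) (mset_set (Poly_Mapping.keys m))" for m
    unfolding exps_def by (simp flip: sorted_list_of_mset_set)
  have k: "\<pi> ` Poly_Mapping.keys (Poly_Mapping.map_key \<pi> m) = Poly_Mapping.keys m"
    using assms by (simp add: Poly_Mapping.keys_map_key[OF inj] surj_image_vimage_eq bij_is_surj)
  have "mset (exps (Poly_Mapping.map_key \<pi> m)) =
      image_mset (Poly_Mapping.lookup m) (image_mset \<pi> (mset_set (Poly_Mapping.keys (Poly_Mapping.map_key \<pi> m))))"
    unfolding e by (simp add: Poly_Mapping.map_key.rep_eq[OF inj] multiset.map_comp)
  also have "\<dots> = mset (exps m)"
    unfolding e by (simp add: image_mset_mset_set[OF inj_on_subset[OF inj]] k)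
  finally show ?thesis .
qed

section \<open>Symmetry\<close>

text \<open>Exchanges of neighbours generate all rearrangements, so symmetry in the variables
  reduces to swapping two adjacent exponents.\<close>

lemma mset_invariantI:
  assumes "\<And>xs a b ys. f (xs @ a # b # ys) = f (xs @ b # a # ys)" "mset xs = mset ys"
  shows "f xs = f ys"
  using assms
proof (induction xs arbitrary: ys f)
  case (Cons x xs)
  have move: "f (p @ q @ x # r) = f (p @ x # q @ r)" for p q r
  proof (induction q arbitrary: p)
    case (Cons a q)
    have "f (p @ a # q @ x # r) = f (p @ a # x # q @ r)" using Cons[of "p @ [a]"] by simp
    then show ?case using \<open>\<And>xs a b ys. f (xs @ a # b # ys) = f (xs @ b # a # ys)\<close> by simp
  qed simp
  have "x \<in> set ys" using Cons.prems(2) by (metis list.set_intros(1) mset_eq_setD)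
  then obtain p q where ys: "ys = p @ x # q" by (meson split_list)
  have "mset xs = mset (p @ q)" using Cons.prems(2) ys by simp
  moreover have "f (x # us @ a # b # vs) = f (x # us @ b # a # vs)" for us a b vs
    using Cons.prems(1)[of "x # us"] by simp
  ultimately have "f (x # xs) = f (x # p @ q)"
    using Cons.IH[of "\<lambda>us. f (x # us)"] by simp
  then show ?case using move[of "[]" p q] ys by simp
qed simp

lemma block_compat_snoc:
  assumes "transp P"
  shows "block_compat P (\<beta> @ [b]) q \<longleftrightarrow> sum_list \<beta> + b = length q \<and>
    block_compat P \<beta> (take (sum_list \<beta>) q) \<and> sorted_wrt P (drop (sum_list \<beta>) q)"
proof (cases "sum_list \<beta> + b = length q")
  case len: True
  let ?s = "sum_list \<beta>"
  have "block_compat P (\<beta> @ [b]) q \<longleftrightarrow>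
      (\<forall>i. Suc i < length q \<longrightarrow> \<not> P (q ! i) (q ! Suc i) \<longrightarrow> Suc i \<in> psums \<beta>)"
    unfolding block_compat_def psums_snoc using len by auto
  also have "\<dots> \<longleftrightarrow> block_compat P \<beta> (take ?s q) \<and> sorted_wrt P (drop ?s q)" (is "?L \<longleftrightarrow> ?R")
  proof
    assume L: ?L
    have "P (q ! (?s + i)) (q ! (?s + Suc i))" if "Suc i < b" for i
      using L[rule_format, of "?s + i"] that len psums_le[of "Suc (?s + i)" \<beta>] by auto
    then show ?R using L len
      by (auto simp: block_compat_def sorted_wrt_iff_nth_Suc_transp[OF assms])
  next
    assume R: ?R
    show ?L
    proof (intro allI impI)
      fix i assume i: "Suc i < length q" "\<not> P (q ! i) (q ! Suc i)"
      consider "Suc i < ?s" | "Suc i = ?s" | "?s \<le> i" by linarith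
      then show "Suc i \<in> psums \<beta>"
      proof cases
        case 1 then show ?thesis using R i len by (auto simp: block_compat_def)
      next
        case 2 then show ?thesis by simp
      next
        case 3
        then have "P (q ! (?s + (i - ?s))) (q ! (?s + Suc (i - ?s)))"
          using R i len 3 by (auto simp: sorted_wrt_iff_nth_Suc_transp[OF assms] dest!: spec[of _ "i - ?s"])
        then show ?thesis using i 3 by simp
      qed
    qed
  qed
  finally show ?thesis using len by simp
qed (auto simp: block_compat_def)

section \<open>Weakly decreasing final blocks and horizontal strips\<close>

abbreviation wdec :: "nat list \<Rightarrow> bool" where
  "wdec \<equiv> sorted_wrt (\<lambda>x y. y \<le> x)"

lemma transp_ge: "transp (\<lambda>x y. y \<le> (x::nat))"
  by (auto intro: transpI)

lemma wdec_split: "wdec zs \<Longrightarrow> zs = filter (\<lambda>x. r < x) zs @ filter (\<lambda>x. x \<le> r) zs"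
proof (induction zs)
  case (Cons z zs)
  show ?case
  proof (cases "r < z")
    case True then show ?thesis using Cons by simp
  next
    case False
    then have "\<forall>x\<in>set zs. x \<le> r" using Cons.prems by auto
    then have "filter (\<lambda>x. r < x) zs = []" "filter (\<lambda>x. x \<le> r) zs = zs"
      by (auto simp: filter_empty_conv filter_id_conv)
    then show ?thesis using False by simp
  qed
qed simp

text \<open>In a weakly decreasing block every \<open>Suc r\<close> precedes every \<open>r\<close>,
  so the ballot condition is tightest when all letters above \<open>r\<close> have been placed and
  no \<open>r\<close> yet. What remains is one inequality per row: the new row \<open>Suc r\<close>
  is no longer than the old row \<open>r\<close>.\<close>

lemma lattice_word_append_wdec:
  assumes "wdec zs"
  shows "lattice_word (ys @ zs) \<longleftrightarrow>
    lattice_word ys \<and> (\<forall>r. count_list (ys @ zs) (Suc r) \<le> count_list ys r)"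
proof
  assume L: "lattice_word (ys @ zs)"
  have "count_list (ys @ zs) (Suc r) \<le> count_list ys r" for r
  proof -
    let ?p = "filter (\<lambda>x. r < x) zs" and ?q = "filter (\<lambda>x. x \<le> r) zs"
    have z: "zs = ?p @ ?q" by (rule wdec_split[OF assms])
    have "lattice_word (ys @ ?p)"
      using lattice_word_take[OF L, of "length (ys @ ?p)"] by (subst (asm) z) (simp del: filter_append)
    then have "count_list (ys @ ?p) (Suc r) \<le> count_list (ys @ ?p) r" by (rule lattice_word_count)
    moreover have "count_list ?p r = 0" "count_list ?q (Suc r) = 0"
      by (auto simp: count_list_0_iff)
    moreover have "count_list zs (Suc r) = count_list ?p (Suc r) + count_list ?q (Suc r)"
      by (subst z) simp
    ultimately show ?thesis by simp
  qed
  then show "lattice_word ys \<and> (\<forall>r. count_list (ys @ zs) (Suc r) \<le> count_list ys r)"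
    using lattice_word_take[OF L, of "length ys"] by simp
next
  assume R: "lattice_word ys \<and> (\<forall>r. count_list (ys @ zs) (Suc r) \<le> count_list ys r)"
  show "lattice_word (ys @ zs)"
    unfolding lattice_word_def
  proof (intro allI)
    fix k r
    show "count_list (take k (ys @ zs)) (Suc r) \<le> count_list (take k (ys @ zs)) r"
    proof (cases "k \<le> length ys")
      case True then show ?thesis using R by (simp add: lattice_word_def)
    next
      case False
      have "count_list (take k (ys @ zs)) (Suc r) \<le> count_list (ys @ zs) (Suc r)"
        using count_take_mono[of k "max k (length (ys @ zs))" "ys @ zs"] by simp
      also have "\<dots> \<le> count_list ys r" using R by simp
      also have "\<dots> \<le> count_list (take k (ys @ zs)) r" using False by simp
      finally show ?thesis .
    qed
  qed
qed

text \<open>For a partition \<mu> these words encode the semistandard tableaux of shape \<mu> and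
  content \<beta>, one block for each value, so their number is a Kostka number.\<close>

definition block_words :: "(nat \<Rightarrow> nat) \<Rightarrow> nat list \<Rightarrow> nat list set" where
  "block_words \<mu> \<beta> = {q \<in> lattice_words \<mu>. block_compat (\<lambda>x y. y \<le> x) \<beta> q}"

text \<open>The shapes \<open>\<kappa>\<close> for which \<open>\<mu> / \<kappa>\<close> is a horizontal strip of size \<open>b\<close>; here \<open>M\<close> bounds the
  number of rows of \<open>\<mu>\<close>.\<close>

definition hstrips :: "nat \<Rightarrow> nat \<Rightarrow> (nat \<Rightarrow> nat) \<Rightarrow> (nat \<Rightarrow> nat) set" where
  "hstrips M b \<mu> = {\<kappa>. (\<forall>r. \<mu> (Suc r) \<le> \<kappa> r \<and> \<kappa> r \<le> \<mu> r) \<and> (\<Sum>r<M. \<kappa> r) + b = (\<Sum>r<M. \<mu> r)}"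

lemma finite_below:
  fixes \<mu> :: "nat \<Rightarrow> nat"
  assumes "\<forall>r\<ge>M. \<mu> r = 0"
  shows "finite {\<kappa>. \<forall>r. \<kappa> r \<le> \<mu> r}"
proof -
  have "finite {f. \<forall>r. (r \<in> {..<M} \<longrightarrow> f r \<in> {..sum \<mu> {..<M}}) \<and> (r \<notin> {..<M} \<longrightarrow> f r = 0)}"
    by (intro finite_set_of_finite_funs) auto
  moreover have "\<mu> r \<le> sum \<mu> {..<M}" if "r < M" for r
    using that by (intro member_le_sum) auto
  then have "{\<kappa>. \<forall>r. \<kappa> r \<le> \<mu> r} \<subseteq> {f. \<forall>r. (r \<in> {..<M} \<longrightarrow> f r \<in> {..sum \<mu> {..<M}}) \<and> (r \<notin> {..<M} \<longrightarrow> f r = 0)}"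
    using assms by (auto intro: order_trans) (metis le_zero_eq not_less)
  ultimately show ?thesis by (rule rev_finite_subset)
qed

lemma lattice_words_length:
  assumes "\<forall>r\<ge>M. \<mu> r = 0" "q \<in> lattice_words \<mu>"
  shows "length q = (\<Sum>r<M. \<mu> r)" "set q \<subseteq> {..<M}"
proof -
  have c: "count_list q = \<mu>" using assms(2) by (simp add: lattice_words_def)
  have "x < M" if "x \<in> set q" for x
    using that assms(1) c by (metis count_list_0_iff not_less)
  then show s: "set q \<subseteq> {..<M}" by auto
  show "length q = (\<Sum>r<M. \<mu> r)" using sum_count_set[OF s] c by simp
qed

lemma finite_lattice_words:
  assumes "\<forall>r\<ge>M. \<mu> r = 0"
  shows "finite (lattice_words \<mu>)"
proof (rule finite_subset)
  show "lattice_words \<mu> \<subseteq> {q. set q \<subseteq> {..<M} \<and> length q = (\<Sum>r<M. \<mu> r)}"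
    using lattice_words_length[OF assms] by blast
qed (intro finite_lists_length_eq finite_lessThan)

lemma wdec_unique:
  assumes "wdec zs" "wdec zs'" "count_list zs = count_list zs'"
  shows "zs = zs'"
proof -
  have "mset (rev zs) = mset (rev zs')"
    using assms(3) by (simp add: multiset_eq_iff count_mset)
  moreover have "sorted (rev zs)" "sorted (rev zs')" using assms by (auto simp: sorted_wrt_rev)
  ultimately have "rev zs = rev zs'" by (metis properties_for_sort sort_key_id_if_sorted sorted_sort_id)
  then show ?thesis by simp
qed

lemma wdec_exists: "\<exists>zs. wdec zs \<and> set zs \<subseteq> {..<M} \<and> (\<forall>r<M. count_list zs r = \<nu> r)"
proof (induction M)
  case (Suc M)
  then obtain zs where zs: "wdec zs" "set zs \<subseteq> {..<M}" "\<forall>r<M. count_list zs r = \<nu> r" by blast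
  have rep: "count_list (replicate n a) x = (if x = a then n else 0)" for n a and x :: nat
    by (induction n) auto
  have "sorted_wrt (\<lambda>x y. y \<le> x) (replicate n a)" for n and a :: nat
    by (induction n) auto
  then have "wdec (replicate (\<nu> M) M @ zs)"
    using zs by (auto simp: sorted_wrt_append intro: less_imp_le)
  moreover have "count_list zs M = 0" using zs(2) by (auto simp: count_list_0_iff)
  ultimately show ?case using zs
    by (intro exI[of _ "replicate (\<nu> M) M @ zs"]) (auto simp: rep less_Suc_eq)
qed simp

text \<open>Cutting off the last block loses nothing: the block is weakly decreasing, so it is
  determined by its content, the rowwise difference of \<mu> and the shape \<kappa> of the prefix.
  Its ballot condition is the strip condition.\<close>

lemma block_words_snoc_bij:
  assumes M: "\<forall>r\<ge>M. \<mu> r = 0"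
  shows "bij_betw (take (sum_list \<beta>)) (block_words \<mu> (\<beta> @ [b])) (\<Union>\<kappa>\<in>hstrips M b \<mu>. block_words \<kappa> \<beta>)"
  unfolding bij_betw_def
proof
  let ?s = "sum_list \<beta>"
  have split: "wdec (drop ?s q)" "length q = ?s + b" "block_compat (\<lambda>x y. y \<le> x) \<beta> (take ?s q)"
      "lattice_word (take ?s q)" "count_list q = \<mu>"
      "\<forall>r. \<mu> (Suc r) \<le> count_list (take ?s q) r"
    if "q \<in> block_words \<mu> (\<beta> @ [b])" for q
  proof -
    have *: "lattice_word q" "count_list q = \<mu>" "block_compat (\<lambda>x y. y \<le> x) (\<beta> @ [b]) q"
      using that by (auto simp: block_words_def lattice_words_def)
    then show w: "wdec (drop ?s q)" and "length q = ?s + b" "block_compat (\<lambda>x y. y \<le> x) \<beta> (take ?s q)"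
        "count_list q = \<mu>"
      using block_compat_snoc[OF transp_ge] by auto
    show "lattice_word (take ?s q)" "\<forall>r. \<mu> (Suc r) \<le> count_list (take ?s q) r"
      using lattice_word_append_wdec[OF w, of "take ?s q"] * by auto
  qed
  show "inj_on (take ?s) (block_words \<mu> (\<beta> @ [b]))"
  proof (rule inj_onI)
    fix q q' assume q: "q \<in> block_words \<mu> (\<beta> @ [b])" "q' \<in> block_words \<mu> (\<beta> @ [b])" "take ?s q = take ?s q'"
    have "count_list (take ?s q) r + count_list (drop ?s q) r = \<mu> r"
      "count_list (take ?s q') r + count_list (drop ?s q') r = \<mu> r" for r
      using split(5)[OF q(1)] split(5)[OF q(2)] by (metis append_take_drop_id count_list_append)+
    then have "count_list (drop ?s q) = count_list (drop ?s q')"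
      using q(3) by (metis (no_types) add_left_cancel ext)
    then have "drop ?s q = drop ?s q'" using wdec_unique split(1) q by blast
    then show "q = q'" using q(3) by (metis append_take_drop_id)
  qed
  show "take ?s ` block_words \<mu> (\<beta> @ [b]) = (\<Union>\<kappa>\<in>hstrips M b \<mu>. block_words \<kappa> \<beta>)"
  proof (intro equalityI subsetI)
    fix p assume "p \<in> take ?s ` block_words \<mu> (\<beta> @ [b])"
    then obtain q where q: "q \<in> block_words \<mu> (\<beta> @ [b])" "p = take ?s q" by blast
    let ?\<kappa> = "count_list p"
    have le: "?\<kappa> r \<le> \<mu> r" for r
      using split(5)[OF q(1)] q(2) by (metis append_take_drop_id count_list_append le_add1)
    have pl: "p \<in> lattice_words ?\<kappa>" using split(4)[OF q(1)] q(2) by (simp add: lattice_words_def)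
    have "\<forall>r\<ge>M. ?\<kappa> r = 0" using M le by (metis le_zero_eq)
    then have "(\<Sum>r<M. ?\<kappa> r) = length p" using lattice_words_length(1) pl by metis
    moreover have "(\<Sum>r<M. \<mu> r) = length q"
      using lattice_words_length(1)[OF M] q(1) by (simp add: block_words_def)
    ultimately have "?\<kappa> \<in> hstrips M b \<mu>"
      using le split(6)[OF q(1)] split(2)[OF q(1)] q(2) by (simp add: hstrips_def)
    moreover have "p \<in> block_words ?\<kappa> \<beta>" using pl split(3)[OF q(1)] q(2) by (simp add: block_words_def)
    ultimately show "p \<in> (\<Union>\<kappa>\<in>hstrips M b \<mu>. block_words \<kappa> \<beta>)" by blast
  next
    fix p assume "p \<in> (\<Union>\<kappa>\<in>hstrips M b \<mu>. block_words \<kappa> \<beta>)"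
    then obtain \<kappa> where \<kappa>: "\<kappa> \<in> hstrips M b \<mu>" and p: "p \<in> lattice_words \<kappa>" "block_compat (\<lambda>x y. y \<le> x) \<beta> p"
      by (auto simp: block_words_def)
    have \<kappa>M: "\<forall>r\<ge>M. \<kappa> r = 0" using M \<kappa> by (auto simp: hstrips_def) (metis le_zero_eq)
    obtain zs where zs: "wdec zs" "set zs \<subseteq> {..<M}" "\<forall>r<M. count_list zs r = \<mu> r - \<kappa> r"
      using wdec_exists[of M "\<lambda>r. \<mu> r - \<kappa> r"] by blast
    have cz: "count_list zs r = \<mu> r - \<kappa> r" for r
    proof (cases "r < M")
      case False
      then have "r \<notin> set zs" using zs(2) by auto
      then show ?thesis using M False by simp
    qed (use zs in simp)
    have c: "count_list (p @ zs) r = \<mu> r" for r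
      using cz[of r] p(1) \<kappa> by (auto simp: lattice_words_def hstrips_def fun_eq_iff)
    have lp: "length p = ?s" using p(2) by (simp add: block_compat_def)
    have "lattice_word (p @ zs)"
      unfolding lattice_word_append_wdec[OF zs(1)] c using p(1) \<kappa>
      by (auto simp: lattice_words_def hstrips_def)
    then have q: "p @ zs \<in> lattice_words \<mu>" using c by (auto simp: lattice_words_def)
    have "length (p @ zs) = ?s + b"
      using lattice_words_length(1)[OF M q] lattice_words_length(1)[OF \<kappa>M p(1)] \<kappa> lp
      by (simp add: hstrips_def)
    then have "block_compat (\<lambda>x y. y \<le> x) (\<beta> @ [b]) (p @ zs)"
      unfolding block_compat_snoc[OF transp_ge] using lp p(2) zs(1) by simp
    then have "p @ zs \<in> block_words \<mu> (\<beta> @ [b])" using q by (simp add: block_words_def)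
    then show "p \<in> take ?s ` block_words \<mu> (\<beta> @ [b])" using lp by (intro image_eqI[of _ _ "p @ zs"]) auto
  qed
qed

lemma card_block_words_snoc:
  assumes M: "\<forall>r\<ge>M. \<mu> r = 0"
  shows "card (block_words \<mu> (\<beta> @ [b])) = (\<Sum>\<kappa>\<in>hstrips M b \<mu>. card (block_words \<kappa> \<beta>))"
proof -
  have fin: "finite (hstrips M b \<mu>)"
    by (rule finite_subset[OF _ finite_below[OF M]]) (auto simp: hstrips_def)
  have "finite (block_words \<kappa> \<beta>)" if "\<kappa> \<in> hstrips M b \<mu>" for \<kappa>
  proof -
    have "\<forall>r\<ge>M. \<kappa> r = 0" using M that by (auto simp: hstrips_def) (metis le_zero_eq)
    then show ?thesis using finite_lattice_words unfolding block_words_def by simp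
  qed
  then have "card (\<Union>\<kappa>\<in>hstrips M b \<mu>. block_words \<kappa> \<beta>) = (\<Sum>\<kappa>\<in>hstrips M b \<mu>. card (block_words \<kappa> \<beta>))"
    using fin by (intro card_UN_disjoint) (auto simp: block_words_def lattice_words_def)
  then show ?thesis using bij_betw_same_card[OF block_words_snoc_bij[OF M]] by metis
qed

text \<open>Between \<open>\<iota>\<close> and \<open>\<mu>\<close> the row lengths of the intermediate shape vary independently in
  intervals \<open>[L r, U r]\<close> with \<open>\<Sum>r. L r + U r = |\<iota>| + |\<mu>|\<close>, so reflecting each interval exchanges
  the sizes of the two strips.\<close>

lemma card_two_strips:
  assumes M: "\<forall>r\<ge>M. \<mu> r = 0"
  shows "card {\<kappa> \<in> hstrips M c \<mu>. \<iota> \<in> hstrips M b \<kappa>} = card {\<kappa> \<in> hstrips M b \<mu>. \<iota> \<in> hstrips M c \<kappa>}"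
proof (cases "\<forall>r. \<iota> r \<le> \<mu> r")
  case le: True
  define L where "L r = max (\<mu> (Suc r)) (\<iota> r)" for r
  \<comment> \<open>The strip over \<iota> bounds each row of \<kappa> by the next lower row of
    \<iota>; the bottom row is bounded by \<mu> alone.\<close>
  define U where "U r = (case r of 0 \<Rightarrow> \<mu> 0 | Suc r' \<Rightarrow> min (\<mu> r) (\<iota> r'))" for r
  define f where "f \<kappa> r = L r + U r - \<kappa> r" for \<kappa> r
  define S where "S b c = {\<kappa> \<in> hstrips M c \<mu>. \<iota> \<in> hstrips M b \<kappa>}" for b c
  have S: "\<kappa> \<in> S b c \<longleftrightarrow> (\<forall>r. L r \<le> \<kappa> r \<and> \<kappa> r \<le> U r) \<and>
      (\<Sum>r<M. \<kappa> r) + c = (\<Sum>r<M. \<mu> r) \<and> (\<Sum>r<M. \<iota> r) + b = (\<Sum>r<M. \<kappa> r)" for \<kappa> b c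
  proof -
    have "(\<forall>r. \<mu> (Suc r) \<le> \<kappa> r \<and> \<kappa> r \<le> \<mu> r) \<and> (\<forall>r. \<kappa> (Suc r) \<le> \<iota> r \<and> \<iota> r \<le> \<kappa> r) \<longleftrightarrow>
        (\<forall>r. L r \<le> \<kappa> r \<and> \<kappa> r \<le> U r)" (is "?A \<longleftrightarrow> ?B")
    proof
      assume ?A
      then show ?B by (auto simp: L_def U_def split: nat.split)
    next
      assume B: ?B
      have "\<kappa> r \<le> \<mu> r" for r using B[rule_format, of r] by (cases r) (auto simp: U_def)
      moreover have "\<kappa> (Suc r) \<le> \<iota> r" for r using B[rule_format, of "Suc r"] by (auto simp: U_def)
      ultimately show ?A using B by (auto simp: L_def)
    qed
    then show ?thesis unfolding S_def hstrips_def by blast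
  qed
  \<comment> \<open>\<open>L r\<close> and \<open>U (Suc r)\<close> are the maximum and the minimum
    of the same two numbers. After this shift only \<open>U 0 = \<mu> 0\<close> is left at one end,
    and the term added at the other end is zero.\<close>
  have LU: "(\<Sum>r<M. L r + U r) = (\<Sum>r<M. \<mu> r) + (\<Sum>r<M. \<iota> r)"
  proof (cases M)
    case (Suc M')
    have z: "\<mu> M = 0" "\<iota> M = 0" using M le by (auto, metis le_refl le_zero_eq)
    have "(\<Sum>r<M. U r) = \<mu> 0 + (\<Sum>r<M'. min (\<mu> (Suc r)) (\<iota> r))"
      unfolding Suc sum.lessThan_Suc_shift by (simp add: U_def)
    also have "\<dots> = \<mu> 0 + (\<Sum>r<M. min (\<mu> (Suc r)) (\<iota> r))" using z by (simp add: Suc)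
    finally have "(\<Sum>r<M. L r + U r) = \<mu> 0 + (\<Sum>r<M. L r + min (\<mu> (Suc r)) (\<iota> r))"
      by (simp add: sum.distrib)
    moreover have "L r + min (\<mu> (Suc r)) (\<iota> r) = \<mu> (Suc r) + \<iota> r" for r
      by (simp add: L_def max_def min_def)
    then have "\<mu> 0 + (\<Sum>r<M. L r + min (\<mu> (Suc r)) (\<iota> r)) = \<mu> 0 + (\<Sum>r<M. \<mu> (Suc r)) + (\<Sum>r<M. \<iota> r)"
      by (simp add: sum.distrib)
    moreover have "\<mu> 0 + (\<Sum>r<M. \<mu> (Suc r)) = (\<Sum>r<Suc M. \<mu> r)"
      by (simp only: sum.lessThan_Suc_shift)
    ultimately show ?thesis using z by simp
  qed simp
  have sumf: "(\<Sum>r<M. f \<kappa> r) + (\<Sum>r<M. \<kappa> r) = (\<Sum>r<M. \<mu> r) + (\<Sum>r<M. \<iota> r)"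
    if "\<forall>r. L r \<le> \<kappa> r \<and> \<kappa> r \<le> U r" for \<kappa>
  proof -
    have "f \<kappa> r + \<kappa> r = L r + U r" for r using that[rule_format, of r] by (simp add: f_def)
    then show ?thesis unfolding LU[symmetric] by (simp add: sum.distrib[symmetric])
  qed
  have fS: "f \<kappa> \<in> S c b \<and> f (f \<kappa>) = \<kappa>" if "\<kappa> \<in> S b c" for \<kappa> b c
  proof -
    have \<kappa>: "\<forall>r. L r \<le> \<kappa> r \<and> \<kappa> r \<le> U r" using that S by blast
    have "L r \<le> f \<kappa> r \<and> f \<kappa> r \<le> U r" for r using \<kappa>[rule_format, of r] by (auto simp: f_def)
    moreover have "f (f \<kappa>) r = \<kappa> r" for r using \<kappa>[rule_format, of r] by (auto simp: f_def)
    ultimately show ?thesis using sumf[OF \<kappa>] that unfolding S by auto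
  qed
  have "bij_betw f (S b c) (S c b)"
    using fS by (intro bij_betw_byWitness[of _ f]) auto
  then show ?thesis using bij_betw_same_card unfolding S_def by blast
next
  case False
  then have *: "{\<kappa> \<in> hstrips M c \<mu>. \<iota> \<in> hstrips M b \<kappa>} = {}" for b c
    by (auto simp: hstrips_def) (meson order_trans)
  show ?thesis by (simp only: *)
qed

lemma card_block_words_swap:
  assumes "\<forall>r\<ge>M. \<mu> r = 0"
  shows "card (block_words \<mu> (\<beta> @ b # c # \<gamma>)) = card (block_words \<mu> (\<beta> @ c # b # \<gamma>))"
  using assms
proof (induction \<gamma> arbitrary: \<mu> rule: rev_induct)
  case Nil
  \<comment> \<open>The inner shapes range over one finite set that does not depend on \<kappa>, so
    that the two summations can be exchanged.\<close>
  let ?D = "{\<iota>. \<forall>r. \<iota> r \<le> \<mu> r}"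
  have D: "finite ?D" using finite_below[OF Nil] .
  have fin: "finite (hstrips M b \<mu>)" for b
    by (rule finite_subset[OF _ D]) (auto simp: hstrips_def)
  have *: "card (block_words \<mu> (\<beta> @ [b, c])) =
      (\<Sum>\<iota>\<in>?D. card {\<kappa> \<in> hstrips M c \<mu>. \<iota> \<in> hstrips M b \<kappa>} * card (block_words \<iota> \<beta>))" for b c
  proof -
    have \<kappa>: "(\<forall>r\<ge>M. \<kappa> r = 0) \<and> hstrips M b \<kappa> \<subseteq> ?D" if "\<kappa> \<in> hstrips M c \<mu>" for \<kappa>
      using Nil that by (auto simp: hstrips_def) (metis le_zero_eq, meson order_trans)
    have "card (block_words \<mu> ((\<beta> @ [b]) @ [c])) =
        (\<Sum>\<kappa>\<in>hstrips M c \<mu>. \<Sum>\<iota>\<in>hstrips M b \<kappa>. card (block_words \<iota> \<beta>))"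
      unfolding card_block_words_snoc[OF Nil] using \<kappa>
      by (intro sum.cong refl card_block_words_snoc) blast
    also have "\<dots> = (\<Sum>\<kappa>\<in>hstrips M c \<mu>. \<Sum>\<iota>\<in>?D. if \<iota> \<in> hstrips M b \<kappa> then card (block_words \<iota> \<beta>) else 0)"
    proof (rule sum.cong[OF refl])
      fix \<kappa> assume "\<kappa> \<in> hstrips M c \<mu>"
      then have "hstrips M b \<kappa> = ?D \<inter> hstrips M b \<kappa>" using \<kappa> by blast
      then show "(\<Sum>\<iota>\<in>hstrips M b \<kappa>. card (block_words \<iota> \<beta>)) =
          (\<Sum>\<iota>\<in>?D. if \<iota> \<in> hstrips M b \<kappa> then card (block_words \<iota> \<beta>) else 0)"
        using sum.inter_restrict[OF D, of "\<lambda>\<iota>. card (block_words \<iota> \<beta>)" "hstrips M b \<kappa>"] by simp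
    qed
    also have "\<dots> = (\<Sum>\<iota>\<in>?D. \<Sum>\<kappa>\<in>hstrips M c \<mu>. if \<iota> \<in> hstrips M b \<kappa> then card (block_words \<iota> \<beta>) else 0)"
      by (rule sum.swap)
    also have "\<dots> = (\<Sum>\<iota>\<in>?D. card {\<kappa> \<in> hstrips M c \<mu>. \<iota> \<in> hstrips M b \<kappa>} * card (block_words \<iota> \<beta>))"
    proof (rule sum.cong[OF refl])
      fix \<iota>
      show "(\<Sum>\<kappa>\<in>hstrips M c \<mu>. if \<iota> \<in> hstrips M b \<kappa> then card (block_words \<iota> \<beta>) else 0) =
          card {\<kappa> \<in> hstrips M c \<mu>. \<iota> \<in> hstrips M b \<kappa>} * card (block_words \<iota> \<beta>)"
        by (subst sum.inter_filter[OF fin, symmetric]) simp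
    qed
    finally show ?thesis by simp
  qed
  show ?case unfolding * using card_two_strips[OF Nil] by simp
next
  case (snoc d \<gamma>)
  have \<kappa>: "\<forall>r\<ge>M. \<kappa> r = 0" if "\<kappa> \<in> hstrips M d \<mu>" for \<kappa>
    using snoc.prems that by (auto simp: hstrips_def) (metis le_zero_eq)
  show ?case
    using card_block_words_snoc[OF snoc.prems, of "\<beta> @ b # c # \<gamma>" d]
      card_block_words_snoc[OF snoc.prems, of "\<beta> @ c # b # \<gamma>" d] snoc.IH[OF \<kappa>] by simp
qed

lemma schur_eq_card:
  assumes "is_partition lam"
  shows "schur lam m = int (card (block_words (part_fun lam) (exps m)))"
proof -
  have "finite (lattice_words (part_fun lam))"
    by (rule finite_lattice_words[of "length lam"]) (simp add: part_fun_def)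
  then show ?thesis
    unfolding schur_lattice_words[OF assms] fundamental_run_lens block_words_def
    by (simp add: Int_def)
qed

lemma schur_symmetric:
  assumes "is_partition lam" "bij \<pi>"
  shows "schur lam (Poly_Mapping.map_key \<pi> m) = schur lam m"
proof -
  have M: "\<forall>r\<ge>length lam. part_fun lam r = 0" by (simp add: part_fun_def)
  have "card (block_words (part_fun lam) (exps (Poly_Mapping.map_key \<pi> m))) =
      card (block_words (part_fun lam) (exps m))"
    by (rule mset_invariantI[where f = "\<lambda>\<beta>. card (block_words (part_fun lam) \<beta>)"])
      (rule card_block_words_swap[OF M], rule mset_exps_map_key[OF assms(2)])
  then show ?thesis by (simp add: schur_eq_card[OF assms(1)])
qed

lemma sum_list_exps: "sum_list (exps m) = (\<Sum>k\<in>Poly_Mapping.keys m. Poly_Mapping.lookup m k)"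
  unfolding exps_def by (simp add: sum_list_distinct_conv_sum_set)

lemma fundamental_run_lens_degree:
  "fundamental (run_lens P xs) m \<noteq> 0 \<Longrightarrow> (\<Sum>k\<in>Poly_Mapping.keys m. Poly_Mapping.lookup m k) = length xs"
  unfolding fundamental_run_lens sum_list_exps[symmetric] by (auto simp: block_compat_def)

section \<open>Reduced expressions\<close>

lemma word_perm_simps: "word_perm [] = id" "word_perm (i # \<rho>) = word_perm \<rho> \<circ> transpose i (Suc i)"
  by (auto simp: word_perm_def)

lemma word_perm_append: "word_perm (p @ q) = word_perm q \<circ> word_perm p"
  by (induction p) (auto simp: word_perm_simps)

text \<open>An adjacent transposition keeps the order of every pair of positions except
  \<open>k\<close>, \<open>Suc k\<close>, so a letter adds at most one inversion. Finiteness belongs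
  to the induction because an infinite set would have \<open>card\<close> 0.\<close>

lemma inversions_word_perm:
  "finite {(i, j). i < j \<and> word_perm \<rho> j < word_perm \<rho> i} \<and> inversions (word_perm \<rho>) \<le> length \<rho>"
proof (induction \<rho>)
  case Nil
  have "{(i, j). i < j \<and> id j < id (i::nat)} = {}" by auto
  then show ?case unfolding word_perm_simps inversions_def by (simp only: card.empty finite.emptyI) simp
next
  case (Cons k \<rho>)
  let ?u = "word_perm \<rho>" and ?s = "transpose k (Suc k)"
  let ?I = "\<lambda>u :: nat \<Rightarrow> nat. {(i, j). i < j \<and> u j < u i}"
  let ?J = "insert (k, Suc k) ((\<lambda>(i, j). (?s i, ?s j)) ` ?I ?u)"
  have sub: "?I (?u \<circ> ?s) \<subseteq> ?J"
  proof
    fix x assume "x \<in> ?I (?u \<circ> ?s)"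
    then obtain i j where x: "x = (i, j)" "i < j" "?u (?s j) < ?u (?s i)" by auto
    show "x \<in> ?J"
    proof (cases "x = (k, Suc k)")
      case False
      then have "?s i < ?s j" using x by (auto simp: transpose_def)
      then have "(?s i, ?s j) \<in> ?I ?u" using x by simp
      moreover have "x = (\<lambda>(i, j). (?s i, ?s j)) (?s i, ?s j)" using x by simp
      ultimately show ?thesis by blast
    qed simp
  qed
  have fin: "finite ?J" using Cons by simp
  have "card (?I (?u \<circ> ?s)) \<le> card ?J" using sub fin by (rule card_mono[rotated])
  also have "\<dots> \<le> Suc (card ((\<lambda>(i, j). (?s i, ?s j)) ` ?I ?u))" by (rule card_insert_le_m1[THEN le_trans]) auto
  also have "\<dots> \<le> Suc (card (?I ?u))" using Cons by (simp add: card_image_le)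
  also have "\<dots> \<le> length (k # \<rho>)" using Cons by (simp add: inversions_def)
  finally show ?case unfolding word_perm_simps inversions_def using finite_subset[OF sub fin] by simp
qed

section \<open>Moves preserve the permutation, and reduced words are good\<close>

lemma ck3_word_perm: "ck3 s t \<Longrightarrow> word_perm (rev s) = word_perm (rev t) \<and> set s = set t"
proof (induction rule: ck3.induct)
  case (ck3_yxz x y z)
  then show ?case by (auto simp: word_perm_simps fun_eq_iff transpose_def)
next
  case (ck3_xzy x y z)
  then show ?case by (auto simp: word_perm_simps fun_eq_iff transpose_def)
next
  case (ck3_braid x)
  then show ?case by (auto simp: word_perm_simps fun_eq_iff transpose_def)
qed

lemma ck_word_perm: "ck v w \<Longrightarrow> word_perm (rev v) = word_perm (rev w) \<and> set v = set w"
  unfolding ck_def using ck3_word_perm by (auto simp: word_perm_append)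

lemma cke_word_perm: "cke v w \<Longrightarrow> word_perm (rev v) = word_perm (rev w) \<and> set v = set w"
proof (induction rule: rtranclp_induct)
  case (step y z) then show ?case using ck_word_perm by simp
qed simp

text \<open>A bad factor could be replaced by a shorter word for the same permutation, which would
  then have fewer letters than inversions.\<close>

lemma reduced_good:
  assumes "length v = inversions (word_perm (rev v))"
  shows "good v"
  unfolding good_def
proof (intro allI impI notI)
  fix u assume u: "cke v u" "bad_factor u"
  have shorter: False if "u = p @ s @ q" "word_perm (rev s) = word_perm t" "length t < length s" for p q s t
  proof -
    have "word_perm (rev v) = word_perm (rev q @ t @ rev p)"
      using cke_word_perm[OF u(1)] that by (simp add: word_perm_append)
    then have "inversions (word_perm (rev v)) \<le> length (rev q @ t @ rev p)"
      using inversions_word_perm by metis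
    then show False using assms cke_length[OF u(1)] that by simp
  qed
  from u(2) consider p q x where "u = p @ [x, x] @ q"
    | p q x y where "u = p @ [x, y, x] @ q" "x \<noteq> Suc y" "y \<noteq> Suc x"
    unfolding bad_factor_def by blast
  then show False
  proof cases
    case 1
    then show False using shorter[of p "[x, x]" q "[]"]
      by (simp add: word_perm_simps fun_eq_iff)
  next
    case 2
    have "word_perm (rev [x, y, x]) = word_perm [y]"
      using 2(2,3) by (auto simp: word_perm_simps fun_eq_iff transpose_def)
    then show False using shorter[OF 2(1), of "[y]"] by simp
  qed
qed

lemma reduced_expressions_good: "\<rho> \<in> reduced_expressions n w \<Longrightarrow> good (rev \<rho>)"
  by (intro reduced_good) (auto simp: reduced_expressions_def)

lemma reduced_expressions_cke:
  "rev v \<in> reduced_expressions n w \<Longrightarrow> cke v u \<Longrightarrow> rev u \<in> reduced_expressions n w"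
  using cke_word_perm[of v u] cke_length[of v u] by (auto simp: reduced_expressions_def)

lemma finite_reduced_expressions: "finite (reduced_expressions n w)"
proof (rule finite_subset)
  show "reduced_expressions n w \<subseteq> {\<rho>. set \<rho> \<subseteq> {1..<n} \<and> length \<rho> = inversions w}"
    by (auto simp: reduced_expressions_def)
qed (intro finite_lists_length_eq finite_atLeastLessThan)

subsection \<open>The maps on triples\<close>

text \<open>The effect of \<open>dd i\<close> on the letters with indices \<open>i - 1\<close>,
  \<open>i\<close>, \<open>i + 1\<close>, listed in this order, that is, as they stand in the
  reversed expression.\<close>

definition triple_move :: "nat \<Rightarrow> nat \<Rightarrow> nat \<Rightarrow> nat list" where
  "triple_move a b c =
     (if c = a \<and> (a = b + 1 \<or> b = a + 1) then [b, a, b]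
      else if (a > c \<and> c > b) \<or> (a < c \<and> c < b) then [b, a, c]
      else if (c > a \<and> a > b) \<or> (c < a \<and> a < b) then [a, c, b]
      else [a, b, c])"

lemma letter_rev: "1 \<le> j \<Longrightarrow> j \<le> length a \<Longrightarrow> letter (rev a) j = a ! (j - 1)"
  by (simp add: letter_def rev_nth)

lemma set_letter_rev:
  "1 \<le> j \<Longrightarrow> j \<le> length a \<Longrightarrow> set_letter j x (rev a) = rev (a[j - 1 := x])"
  by (simp add: set_letter_def rev_update)

lemma dd_rev:
  assumes "length u + 2 = i"
  shows "dd i (rev (u @ [a, b, c] @ v)) = rev (u @ triple_move a b c @ v)"
proof -
  let ?w = "u @ [a, b, c] @ v"
  have l: "letter (rev ?w) (i - 1) = a" "letter (rev ?w) i = b" "letter (rev ?w) (i + 1) = c"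
    using assms by (auto simp: letter_rev nth_append simp del: rev_append rev.simps)
  have 1: "swap_move (i - 1) (rev ?w) = rev (u @ [b, a, c] @ v)"
    using l assms unfolding swap_move_def
    by (auto simp: set_letter_rev list_update_append simp del: rev_append rev.simps)
  have 2: "swap_move i (rev ?w) = rev (u @ [a, c, b] @ v)"
    using l assms unfolding swap_move_def
    by (auto simp: set_letter_rev list_update_append simp del: rev_append rev.simps)
  have 3: "braid_move i (rev ?w) = rev (u @ [b, a, b] @ v)"
    using l assms unfolding braid_move_def
    by (auto simp: set_letter_rev list_update_append simp del: rev_append rev.simps)
  show ?thesis unfolding dd_def Let_def l 1 2 3 triple_move_def by auto
qed

lemma length_triple_move [simp]: "length (triple_move a b c) = 3"
  by (simp add: triple_move_def)

lemma triple_move_ck3: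
  "triple_move a b c = [a, b, c] \<or> ck3 [a, b, c] (triple_move a b c) \<or> ck3 (triple_move a b c) [a, b, c]"
  by (auto simp: triple_move_def intro: ck3.intros)

lemma triple_move_cke: "cke (u @ [a, b, c] @ v) (u @ triple_move a b c @ v)"
proof (cases "triple_move a b c = [a, b, c]")
  case False
  then have "ck (u @ [a, b, c] @ v) (u @ triple_move a b c @ v)"
    using triple_move_ck3[of a b c] unfolding ck_def by blast
  then show ?thesis by (rule r_into_rtranclp)
qed simp

text \<open>A triple has at most one partner under \<open>ck3\<close>, taken in both directions.
  Hence a move at a given position is unique and is the one made by \<open>dd\<close>.\<close>

lemma ck3_triple_move:
  "ck3 [a, b, c] t \<or> ck3 t [a, b, c] \<Longrightarrow> t = triple_move a b c"
  by (auto simp: triple_move_def elim!: ck3.cases)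

lemma triple_move_invol: "triple_move a b c = [a', b', c'] \<Longrightarrow> triple_move a' b' c' = [a, b, c]"
  by (auto simp: triple_move_def split: if_splits)

lemma dd_ck3:
  assumes "length u + 2 = i" "ck3 s t \<or> ck3 t s"
  shows "dd i (rev (u @ s @ v)) = rev (u @ t @ v)"
proof -
  have "length s = 3" using assms(2) ck3_length by blast
  then obtain a b c where s: "s = [a, b, c]" by (auto simp: numeral_3_eq_3 length_Suc_conv)
  then show ?thesis using dd_rev[OF assms(1)] ck3_triple_move assms(2) by metis
qed

lemma list_split3:
  assumes "k + 3 \<le> length w"
  obtains u a b c v where "w = u @ [a, b, c] @ v" "length u = k"
proof
  show "w = take k w @ [w ! k, w ! Suc k, w ! Suc (Suc k)] @ drop (Suc (Suc (Suc k))) w"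
    using assms by (simp add: Cons_nth_drop_Suc)
  show "length (take k w) = k" using assms by simp
qed

lemma dd_window:
  assumes "h \<le> j" "j \<le> i" "length u + 2 = h" "length t = i - h + 3"
  shows "\<exists>t'. dd j (rev (u @ t @ v)) = rev (u @ t' @ v) \<and> cke t t'"
proof -
  have "j - h + 3 \<le> length t" using assms by simp
  then obtain p a b c q where t: "t = p @ [a, b, c] @ q" "length p = j - h" by (rule list_split3)
  have "dd j (rev ((u @ p) @ [a, b, c] @ q @ v)) = rev ((u @ p) @ triple_move a b c @ q @ v)"
    using assms t by (intro dd_rev) simp
  moreover have "cke t (p @ triple_move a b c @ q)" unfolding t(1) by (rule triple_move_cke)
  ultimately show ?thesis using t(1) by (intro exI[of _ "p @ triple_move a b c @ q"]) simp
qed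

lemma dd_reduced:
  assumes "\<rho> \<in> reduced_expressions n w" "1 < i" "i < inversions w"
  shows "dd i \<rho> \<in> reduced_expressions n w \<and> dd i (dd i \<rho>) = \<rho>"
proof -
  have "i - 2 + 3 \<le> length (rev \<rho>)" using assms by (auto simp: reduced_expressions_def)
  then obtain u a b c v where r: "rev \<rho> = u @ [a, b, c] @ v" "length u = i - 2" by (rule list_split3)
  then have \<rho>: "\<rho> = rev (u @ [a, b, c] @ v)" by (metis rev_rev_ident)
  have i: "length u + 2 = i" using r assms by simp
  obtain a' b' c' where t: "triple_move a b c = [a', b', c']"
    using length_triple_move[of a b c] unfolding numeral_3_eq_3 length_Suc_conv by blast
  have "cke (u @ [a, b, c] @ v) (u @ [a', b', c'] @ v)"
    using triple_move_cke[of u a b c v] unfolding t .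
  then have "rev (u @ [a', b', c'] @ v) \<in> reduced_expressions n w"
    using assms(1) reduced_expressions_cke unfolding \<rho> by blast
  then show ?thesis
    using triple_move_invol[OF t] t unfolding \<rho> dd_rev[OF i] t dd_rev[OF i] by simp
qed

text \<open>Distance 3 is what makes the index triples around \<open>i\<close> and \<open>j\<close>
  disjoint; \<open>x\<close> below is the stretch between them.\<close>

lemma dd_commute:
  assumes "1 < i" "i + 3 \<le> j" "j < length \<rho>"
  shows "dd j (dd i \<rho>) = dd i (dd j \<rho>)"
proof -
  have "i - 2 + 3 \<le> length (rev \<rho>)" using assms by simp
  then obtain u a b c v where 1: "rev \<rho> = u @ [a, b, c] @ v" "length u = i - 2" by (rule list_split3)
  have "length (rev \<rho>) = i + 1 + length v" using 1 assms by simp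
  then have "j - i - 3 + 3 \<le> length v" using assms by simp
  then obtain x d e f y where 2: "v = x @ [d, e, f] @ y" "length x = j - i - 3" by (rule list_split3)
  have \<rho>: "\<rho> = rev (u @ [a, b, c] @ x @ [d, e, f] @ y)" using 1 2 by (metis rev_rev_ident)
  have i: "length u + 2 = i" using 1 assms by simp
  have j: "dd j (rev (u @ s @ x @ [d, e, f] @ y)) = rev (u @ s @ x @ triple_move d e f @ y)"
    if "length s = 3" for s
    using dd_rev[of "u @ s @ x" j d e f y] that 1 2 assms by simp
  show ?thesis
    unfolding \<rho> dd_rev[OF i] by (simp only: j length_triple_move dd_rev[OF i] list.size)
qed

subsection \<open>Windows\<close>

lemma sum_list_shape: "sum_list (map length T) = length (reading T)"
  by (induction T) auto

text \<open>The maps with indices from \<open>h\<close> to \<open>i\<close> touch only the letters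
  \<open>h - 1\<close> to \<open>i + 1\<close>, which form \<open>t\<close>, while \<open>u\<close>
  and \<open>v\<close> stay fixed. Conversely, every move inside \<open>t\<close> is one of these
  maps.\<close>

lemma generated_class_window:
  assumes R: "rev (u @ t @ v) \<in> reduced_expressions n w"
    and h: "length u + 2 = h" "h \<le> i" "length t = i - h + 3"
  shows "generated_class (reduced_expressions n w) dd h i (rev (u @ t @ v)) =
    (\<lambda>t'. rev (u @ t' @ v)) ` {t'. cke t t'}"
proof (intro equalityI subsetI)
  let ?A = "reduced_expressions n w"
  let ?r = "\<lambda>V V'. V \<in> ?A \<and> (\<exists>j\<in>{h..i}. V' = dd j V)"
  have inR: "rev (u @ t' @ v) \<in> ?A" if "cke t t'" for t'
    using reduced_expressions_cke[OF R cke_context[OF that]] .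
  have len: "length (u @ t @ v) = inversions w" using R by (simp add: reduced_expressions_def)
  {
    fix U assume "U \<in> generated_class ?A dd h i (rev (u @ t @ v))"
    then have "equivclp ?r (rev (u @ t @ v)) U" by (simp add: generated_class_def)
    then show "U \<in> (\<lambda>t'. rev (u @ t' @ v)) ` {t'. cke t t'}"
    proof (induction rule: equivclp_induct)
      case base then show ?case by auto
    next
      case (step y z)
      then obtain t' where t': "y = rev (u @ t' @ v)" "cke t t'" by auto
      have "\<exists>j\<in>{h..i}. z = dd j y"
        using step(2)
      proof
        \<comment> \<open>A backward step is turned into a forward one by the involution
          property.\<close>
        assume "?r z y"
        then obtain j where "z \<in> ?A" "j \<in> {h..i}" "y = dd j z" by blast
        then show ?thesis using dd_reduced[of z n w j] h len by force
      qed blast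
      then obtain j where j: "h \<le> j" "j \<le> i" "z = dd j y" by auto
      have "length t' = i - h + 3" using cke_length[OF t'(2)] h by simp
      then obtain t'' where "z = rev (u @ t'' @ v)" "cke t' t''"
        using dd_window[OF j(1,2) h(1)] t'(1) j(3) by blast
      then show ?case using rtranclp_trans[OF t'(2)] by auto
    qed
  }
  fix U assume "U \<in> (\<lambda>t'. rev (u @ t' @ v)) ` {t'. cke t t'}"
  then obtain t' where "cke t t'" "U = rev (u @ t' @ v)" by auto
  then show "U \<in> generated_class ?A dd h i (rev (u @ t @ v))"
  proof (induction arbitrary: U rule: rtranclp_induct)
    case base then show ?case by (simp add: generated_class_def)
  next
    case (step y z)
    obtain p q s s' where *: "y = p @ s @ q" "z = p @ s' @ q" "ck3 s s' \<or> ck3 s' s"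
      using step(2) unfolding ck_def by blast
    have "length p + length s + length q = i - h + 3"
      using cke_length[OF step(1)] * h by simp
    moreover have "length s = 3" using *(3) ck3_length by blast
    ultimately have "h + length p \<in> {h..i}" using h by auto
    \<comment> \<open>The middle letter of the moved triple is preceded by
      \<open>length u + length p + 1\<close> letters, and \<open>length u = h - 2\<close>.\<close>
    moreover have "U = dd (h + length p) (rev (u @ y @ v))"
      using dd_ck3[of "u @ p" "h + length p" s s' "q @ v"] * h step(4) by simp
    ultimately have "?r (rev (u @ y @ v)) U" using inR[OF step(1)] by blast
    moreover have "equivclp ?r (rev (u @ t @ v)) (rev (u @ y @ v))"
      using step(3) by (simp add: generated_class_def)
    ultimately show ?case
      unfolding generated_class_def by (simp add: equivclp_into_equivclp)
  qed
qed

lemma class_window_schur: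
  assumes T: "T \<in> reduced_expressions n w" and h: "1 < h" "h \<le> i" "i < inversions w"
  shows "\<exists>lam. is_partition lam \<and> sum_list lam = i - h + 3 \<and>
    (\<lambda>m. \<Sum>U\<in>generated_class (reduced_expressions n w) dd h i T.
      fundamental (restrict_composition (h - 1) (i + 1) (word_Des U)) m) = schur lam"
proof -
  define a where "a = rev T"
  \<comment> \<open>The window comprises the letters \<open>h - 1\<close> to \<open>i + 1\<close>,
    hence \<open>i - h + 3\<close> letters after the first \<open>h - 2\<close>.\<close>
  define u where "u = take (h - 2) a"
  define t where "t = take (i - h + 3) (drop (h - 2) a)"
  define v where "v = drop (i - h + 3) (drop (h - 2) a)"
  have len: "length a = inversions w" using T by (simp add: a_def reduced_expressions_def)
  have Ta: "T = rev (u @ t @ v)" by (simp only: u_def t_def v_def append_take_drop_id a_def rev_rev_ident)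
  have lu: "length u + 2 = h" and lt: "length t = i - h + 3"
    using h len by (auto simp: u_def t_def)
  have "good (u @ t @ v)" using reduced_expressions_good[OF T] Ta by simp
  then have g: "good t" by (rule good_factor)
  have D: "restrict_composition (h - 1) (i + 1) (word_Des (rev (u @ t' @ v))) = word_Des (rev t')"
    if "cke t t'" for t'
  proof -
    have l: "length t' = i - h + 3" using cke_length[OF that] lt by simp
    have "drop (h - 1 - 1) (take (i + 1) (u @ t' @ v)) = t'" using l lu h by simp
    moreover have "length (u @ t' @ v) \<ge> i + 1" using l lu by simp
    ultimately show ?thesis unfolding word_Des_rev
      using h by (subst restrict_composition_run_lens) auto
  qed
  have inj: "inj_on (\<lambda>t'. rev (u @ t' @ v)) {t'. cke t t'}" by (auto intro: inj_onI)
  have "(\<Sum>U\<in>generated_class (reduced_expressions n w) dd h i T.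
      fundamental (restrict_composition (h - 1) (i + 1) (word_Des U)) m) = schur (map length (P_tab t)) m" for m
    unfolding Ta generated_class_window[OF T[unfolded Ta] lu h(2) lt] sum.reindex[OF inj] o_def
    unfolding class_sum_schur[OF g, of m, symmetric]
    by (rule sum.cong[OF refl]) (simp only: D mem_Collect_eq)
  moreover have "is_partition (map length (P_tab t))" using P_tab_props[OF g] is_partition_shape by blast
  moreover have "sum_list (map length (P_tab t)) = i - h + 3"
    unfolding sum_list_shape using cke_length[of t "reading (P_tab t)"] P_tab_props[OF g] lt by simp
  ultimately show ?thesis by blast
qed

lemma word_Des_strong_composition: "strong_composition (word_Des \<rho>) (length \<rho>)"
  using run_lens_pos[of _ "\<lambda>x y. y < x" "rev \<rho>"] word_Des_rev[of "rev \<rho>"]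
  by (auto simp: strong_composition_def sum_list_run_lens)

lemma dual_equivalence_reduced_expressions:
  "dual_equivalence (reduced_expressions n w) word_Des (inversions w) dd"
proof -
  have len: "length \<rho> = inversions w" if "\<rho> \<in> reduced_expressions n w" for \<rho>
    using that by (simp add: reduced_expressions_def)
  have comm: "dd j (dd i \<rho>) = dd i (dd j \<rho>)"
    if "\<rho> \<in> reduced_expressions n w" "1 < i" "i < inversions w" "1 < j" "j < inversions w"
      "\<bar>int i - int j\<bar> \<ge> 3" for i j \<rho>
  proof (cases "i < j")
    case True
    then show ?thesis using that len by (intro dd_commute) auto
  next
    case False
    then show ?thesis using that len by (intro dd_commute[symmetric]) auto
  qed
  have comp: "strong_composition (word_Des \<rho>) (inversions w)" if "\<rho> \<in> reduced_expressions n w" for \<rho>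
    using word_Des_strong_composition[of \<rho>] len[OF that] by simp
  show ?thesis
    unfolding dual_equivalence_def
  proof (intro conjI allI impI ballI; (elim conjE)?)
  qed (simp_all only: finite_reduced_expressions comp comm dd_reduced class_window_schur)
qed

section \<open>The Stanley symmetric function\<close>

text \<open>The sum runs over insertion tableaux, not over shapes, so no multiplicities have to be
  counted yet.\<close>

lemma stanley_schur_expansion:
  "stanley n w m = (\<Sum>T\<in>(\<lambda>\<rho>. P_tab (rev \<rho>)) ` reduced_expressions n w. schur (map length T) m)"
proof -
  let ?A = "reduced_expressions n w"
  have "(\<Sum>\<rho> | \<rho> \<in> ?A \<and> P_tab (rev \<rho>) = T. fundamental (word_Des \<rho>) m) = schur (map length T) m"
    if T: "T \<in> (\<lambda>\<rho>. P_tab (rev \<rho>)) ` ?A" for T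
  proof -
    obtain v where v: "rev v \<in> ?A" "P_tab v = T" using T by (metis (no_types, lifting) imageE rev_rev_ident)
    have g: "good v" using reduced_expressions_good[OF v(1)] by simp
    have "{\<rho>. \<rho> \<in> ?A \<and> P_tab (rev \<rho>) = T} = rev ` {u. cke v u}"
    proof (intro equalityI subsetI)
      fix \<rho> assume "\<rho> \<in> {\<rho>. \<rho> \<in> ?A \<and> P_tab (rev \<rho>) = T}"
      then have "cke v (rev \<rho>)" using cke_iff_P_tab[OF g] v reduced_expressions_good by auto
      then show "\<rho> \<in> rev ` {u. cke v u}" by (intro image_eqI[of _ _ "rev \<rho>"]) auto
    next
      fix \<rho> assume "\<rho> \<in> rev ` {u. cke v u}"
      then show "\<rho> \<in> {\<rho>. \<rho> \<in> ?A \<and> P_tab (rev \<rho>) = T}"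
        using reduced_expressions_cke[OF v(1)] cke_iff_P_tab[OF g] v by auto
    qed
    then show ?thesis
      using class_sum_schur[OF g, of m] v(2) by (simp add: sum.reindex)
  qed
  then show ?thesis
    unfolding stanley_def
    by (subst sum.image_gen[OF finite_reduced_expressions, of _ n w "\<lambda>\<rho>. P_tab (rev \<rho>)"])
      (rule sum.cong[OF refl])
qed

lemma stanley_tableau_shapes:
  assumes "T \<in> (\<lambda>\<rho>. P_tab (rev \<rho>)) ` reduced_expressions n w"
  shows "is_partition (map length T)"
  using assms reduced_expressions_good P_tab_props is_partition_shape by blast

lemma stanley_symmetric: "symmetric_function (stanley n w)"
proof -
  \<comment> \<open>The degree bound: a nonzero coefficient comes from a single expression, whose
    fundamental function is homogeneous of degree its length.\<close>
  have "(\<Sum>k\<in>Poly_Mapping.keys m. Poly_Mapping.lookup m k) \<le> inversions w" if nz: "stanley n w m \<noteq> 0" for m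
  proof -
    obtain \<rho> where \<rho>: "\<rho> \<in> reduced_expressions n w" "fundamental (word_Des \<rho>) m \<noteq> 0"
      using nz unfolding stanley_def by (metis (mono_tags, lifting) sum.neutral)
    then have "fundamental (run_lens (\<lambda>x y. y < x) (rev \<rho>)) m \<noteq> 0"
      using word_Des_rev[of "rev \<rho>"] by simp
    then show ?thesis using fundamental_run_lens_degree \<rho>(1) by (fastforce simp: reduced_expressions_def)
  qed
  moreover have "stanley n w (Poly_Mapping.map_key \<pi> m) = stanley n w m" if "bij \<pi>" for \<pi> m
    unfolding stanley_schur_expansion
    using schur_symmetric[OF stanley_tableau_shapes that] by (intro sum.cong refl) blast
  ultimately show ?thesis unfolding symmetric_function_def by blast
qed

lemma stanley_schur_positive: "schur_positive (stanley n w)"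
proof -
  define \<T> where "\<T> = (\<lambda>\<rho>. P_tab (rev \<rho>)) ` reduced_expressions n w"
  have fin: "finite \<T>" unfolding \<T>_def using finite_reduced_expressions by blast
  \<comment> \<open>The multiplicity of a shape is the number of insertion tableaux having
    it.\<close>
  let ?c = "\<lambda>lam. card {T \<in> \<T>. map length T = lam}"
  have "stanley n w m = (\<Sum>lam\<in>map length ` \<T>. int (?c lam) * schur lam m)" for m
  proof -
    have "stanley n w m = (\<Sum>lam\<in>map length ` \<T>. \<Sum>T | T \<in> \<T> \<and> map length T = lam. schur (map length T) m)"
      unfolding stanley_schur_expansion \<T>_def[symmetric] by (rule sum.image_gen[OF fin])
    also have "\<dots> = (\<Sum>lam\<in>map length ` \<T>. int (?c lam) * schur lam m)"
      by (intro sum.cong refl) simp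
    finally show ?thesis .
  qed
  moreover have "\<forall>lam\<in>map length ` \<T>. is_partition lam"
    using stanley_tableau_shapes unfolding \<T>_def by blast
  ultimately show ?thesis
    unfolding schur_positive_def using fin
    by (intro exI[of _ "map length ` \<T>"] exI[of _ ?c]) auto
qed

theorem theorem2p10:
  fixes n :: nat and w :: "nat \<Rightarrow> nat"
  assumes "w permutes {1..n}"
  shows "dual_equivalence (reduced_expressions n w) word_Des (inversions w) dd
    \<and> symmetric_function (stanley n w)
    \<and> schur_positive (stanley n w)"
  using dual_equivalence_reduced_expressions stanley_symmetric stanley_schur_positive by blast

end
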